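(* For all positive integers $k$, we have in $\mathcal A$ $$T_{\mathcal A}(2,\{1\}^k)=(-1)^kT_{\mathcal A}(1,k+1).$$ In particular, if $k$ is odd then $$T_{\mathcal A}(2,\{1\}^k)=-T_{\mathcal A}(1,k+1)=(k+2)(2-2^{-1-k})\beta_{k+2}=\frac{(k+2)(2^{k+2}-1)}{2(2^{k+1}-1)}\,T_{\mathcal A}(k+2).$$ More generally (but in fact equivalently), for all $0\le\ell\le k$ with $k$ odd, we have $$T_{\mathcal A}(\{1\}^\ell,2,\{1\}^{k-\ell})=(-1)^\ell\binom{k+2}{\ell+1}(2-2^{-1-k})\beta_{k+2}.$$
   Context: Let $\mathcal P$ be the set of primes and $\mathcal A=\prod_{p\in\mathcal P}(\mathbb Z/p\mathbb Z)\big/\bigoplus_{p\in\mathcal P}(\mathbb Z/p\mathbb Z)$, a $\mathbb Q$-algebra; two elements are equal iff their components agree for all but finitely many $p$, so components at finitely many primes may be left unspecified. $\{1\}^m$ denotes the string $1,\dots,1$ of length $m$ (empty if $m=0$). For positive integers $s_1,\dots,s_d$, $T_{\mathcal A}(s_1,\dots,s_d)\in\mathcal A$ is the class of $$\Big(\sum_{\substack{p>n_1>\dots>n_d>0\\ n_j\equiv d-j+1 \ (\mathrm{mod}\ 2)}}\frac{2^d}{n_1^{s_1}\cdots n_d^{s_d}} \bmod p\Big)_{p\in\mathcal P}.$$ For $m\ge2$, $\beta_m=\big(\frac{B_{p-m}}{m}\bmod p\big)_{p>m}$, where $\frac{t}{e^t-1}=\sum_{n\ge0}B_n\frac{t^n}{n!}$.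 *)

theory Defs
  imports Complex_Main
    "HOL-Computational_Algebra.Computational_Algebra"
    "HOL-Number_Theory.Number_Theory"
begin

text \<open>
  An element of \<open>\<A>\<close> is represented by a family of integers indexed by the primes, read
  componentwise modulo \<open>p\<close>. Two families represent the same element iff they are congruent
  modulo \<open>p\<close> for all but finitely many primes \<open>p\<close>; this identifies both the integers
  congruent modulo \<open>p\<close> (giving the product of the rings \<open>\<int>/p\<int>\<close>) and the families
  differing by an element of the direct sum. Values at non-prime indices are irrelevant.
\<close>

definition eq_almost_all_primes :: "(nat \<Rightarrow> int) \<Rightarrow> (nat \<Rightarrow> int) \<Rightarrow> bool" where
  "eq_almost_all_primes f g \<longleftrightarrow> finite {p. prime p \<and> \<not> [f p = g p] (mod int p)}"

lemma eq_almost_all_primes_combine: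
  assumes "eq_almost_all_primes f g" "eq_almost_all_primes f' g'"
    and "\<And>p. prime p \<Longrightarrow> [f p = g p] (mod int p) \<Longrightarrow> [f' p = g' p] (mod int p)
           \<Longrightarrow> [h p = h' p] (mod int p)"
  shows "eq_almost_all_primes h h'"
proof -
  have "{p. prime p \<and> \<not> [h p = h' p] (mod int p)} \<subseteq>
          {p. prime p \<and> \<not> [f p = g p] (mod int p)} \<union> {p. prime p \<and> \<not> [f' p = g' p] (mod int p)}"
    using assms(3) by blast
  with assms(1,2) show ?thesis
    unfolding eq_almost_all_primes_def by (meson finite_UnI finite_subset)
qed

lemma eq_almost_all_primes_refl: "eq_almost_all_primes f f"
  by (simp add: eq_almost_all_primes_def)

quotient_type ring_A = "nat \<Rightarrow> int" / eq_almost_all_primes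
proof (rule equivpI)
  show "reflp eq_almost_all_primes"
    by (simp add: reflp_def eq_almost_all_primes_refl)
  show "symp eq_almost_all_primes"
    by (auto simp: symp_def eq_almost_all_primes_def cong_sym_eq)
  show "transp eq_almost_all_primes"
    by (intro transpI) (erule (1) eq_almost_all_primes_combine, blast intro: cong_trans)
qed

instantiation ring_A :: comm_ring_1
begin

lift_definition zero_ring_A :: ring_A is "\<lambda>_. 0" .
lift_definition one_ring_A :: ring_A is "\<lambda>_. 1" .
lift_definition plus_ring_A :: "ring_A \<Rightarrow> ring_A \<Rightarrow> ring_A" is "\<lambda>f g p. f p + g p"
  by (erule (1) eq_almost_all_primes_combine) (rule cong_add)
lift_definition minus_ring_A :: "ring_A \<Rightarrow> ring_A \<Rightarrow> ring_A" is "\<lambda>f g p. f p - g p"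
  by (erule (1) eq_almost_all_primes_combine) (rule cong_diff)
lift_definition times_ring_A :: "ring_A \<Rightarrow> ring_A \<Rightarrow> ring_A" is "\<lambda>f g p. f p * g p"
  by (erule (1) eq_almost_all_primes_combine) (rule cong_mult)
lift_definition uminus_ring_A :: "ring_A \<Rightarrow> ring_A" is "\<lambda>f p. - f p"
  by (erule eq_almost_all_primes_combine, rule eq_almost_all_primes_refl)
     (simp add: cong_minus_minus_iff)

instance
proof
  show "(0::ring_A) \<noteq> 1"
  proof (transfer, rule notI)
    assume "eq_almost_all_primes (\<lambda>_. 0) (\<lambda>_. 1)"
    moreover have "{p::nat. prime p \<and> \<not> [0 = 1] (mod int p)} = {p. prime p}"
      by (auto simp: cong_iff_dvd_diff)
    ultimately show False
      using primes_infinite by (simp add: eq_almost_all_primes_def)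
  qed
qed (transfer, simp add: algebra_simps eq_almost_all_primes_refl)+

end

text \<open>The residue modulo \<open>p\<close> of a rational number whose denominator is not divisible by \<open>p\<close>.\<close>

definition rat_residue :: "nat \<Rightarrow> rat \<Rightarrow> int" where
  "rat_residue p x = (case quotient_of x of (a, b) \<Rightarrow> a * modular_inverse (int p) b mod int p)"

lemma rat_residue_cong:
  assumes p: "prime p" and b: "\<not> int p dvd b"
  shows "[rat_residue p (of_int a / of_int b) * b = a] (mod int p)"
proof -
  obtain n d where nd: "quotient_of (of_int a / of_int b) = (n, d)"
    by fastforce
  have b0: "b \<noteq> 0" using b by auto
  have d0: "d > 0" and cop: "coprime n d"
    using nd quotient_of_denom_pos quotient_of_coprime by blast+
  have "(of_int a / of_int b :: rat) = of_int n / of_int d"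
    using nd quotient_of_div by blast
  hence "(of_int (a * d) :: rat) = of_int (n * b)"
    using b0 d0 by (simp add: field_simps)
  hence eq: "a * d = n * b" by (simp only: of_int_eq_iff)
  hence "d dvd n * b" by (metis dvd_triv_right)
  hence "d dvd b" using cop by (simp add: coprime_commute coprime_dvd_mult_right_iff)
  with b have "\<not> int p dvd d" by (meson dvd_trans)
  hence dp: "coprime d (int p)"
    using p by (metis coprime_commute prime_imp_coprime prime_int_nat_transfer of_nat_0_le_iff nat_int)
  have "[rat_residue p (of_int a / of_int b) * d = n * (modular_inverse (int p) d * d)] (mod int p)"
    by (simp add: rat_residue_def nd Cong.cong_def mod_mult_left_eq mult.assoc)
  also have "[n * (modular_inverse (int p) d * d) = n * 1] (mod int p)"
    by (intro cong_mult cong_refl cong_modular_inverse2 dp)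
  finally have "[rat_residue p (of_int a / of_int b) * d * b = n * 1 * b] (mod int p)"
    by (rule cong_mult[OF _ cong_refl])
  hence "[rat_residue p (of_int a / of_int b) * b * d = a * d] (mod int p)"
    by (simp add: eq mult_ac)
  thus ?thesis using dp by (simp add: cong_mult_rcancel)
qed

lift_definition scale_A :: "rat \<Rightarrow> ring_A \<Rightarrow> ring_A" (infixr "*\<^sub>A" 75)
  is "\<lambda>q f p. rat_residue p q * f p"
  by (erule eq_almost_all_primes_combine, rule eq_almost_all_primes_refl) (intro cong_mult cong_refl)

lemma finite_primes_dvd:
  assumes "b \<noteq> 0"
  shows "finite {p::nat. prime p \<and> int p dvd b}"
proof (rule finite_subset)
  show "{p::nat. prime p \<and> int p dvd b} \<subseteq> {..nat \<bar>b\<bar>}"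
  proof
    fix p assume "p \<in> {p::nat. prime p \<and> int p dvd b}"
    hence "\<bar>int p\<bar> \<le> \<bar>b\<bar>"
      using assms dvd_imp_le_int by blast
    thus "p \<in> {..nat \<bar>b\<bar>}" by simp
  qed
qed simp

lemma eq_almost_all_primesI:
  assumes "b \<noteq> 0" "\<And>p. prime p \<Longrightarrow> \<not> int p dvd b \<Longrightarrow> [f p * b = g p * b] (mod int p)"
  shows "eq_almost_all_primes f g"
proof -
  have "[f p = g p] (mod int p)" if "prime p" "\<not> int p dvd b" for p
  proof -
    have "coprime b (int p)"
      using that by (metis coprime_commute prime_imp_coprime prime_int_nat_transfer of_nat_0_le_iff nat_int)
    with assms(2)[OF that] show ?thesis by (simp add: cong_mult_rcancel)
  qed
  hence "{p. prime p \<and> \<not> [f p = g p] (mod int p)} \<subseteq> {p. prime p \<and> int p dvd b}"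
    by blast
  thus ?thesis
    unfolding eq_almost_all_primes_def using finite_primes_dvd[OF assms(1)] finite_subset by blast
qed

lemma rat_as_quotient: obtains a b where "(x::rat) = of_int a / of_int b" "b \<noteq> 0"
  by (metis less_irrefl prod.exhaust quotient_of_denom_pos quotient_of_div)

lemma not_prime_dvd_mult: "prime p \<Longrightarrow> \<not> int p dvd b * d \<Longrightarrow> \<not> int p dvd b \<and> \<not> int p dvd d"
  by auto

interpretation ring_A: vector_space scale_A
proof
  fix q r :: rat and x y :: ring_A
  obtain a b where q: "q = of_int a / of_int b" "b \<noteq> 0" by (rule rat_as_quotient)
  obtain c d where r: "r = of_int c / of_int d" "d \<noteq> 0" by (rule rat_as_quotient)
  have sum: "q + r = of_int (a * d + c * b) / of_int (b * d)"
    and prod: "q * r = of_int (a * c) / of_int (b * d)"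
    using q r by (simp_all add: field_simps)
  show "q *\<^sub>A (x + y) = q *\<^sub>A x + q *\<^sub>A y"
    by transfer (simp add: algebra_simps eq_almost_all_primes_refl)
  show "(q + r) *\<^sub>A x = q *\<^sub>A x + r *\<^sub>A x"
  proof (transfer fixing: q r, rule eq_almost_all_primesI[of "b * d"])
    fix f :: "nat \<Rightarrow> int" and p :: nat assume p: "prime p" and nd: "\<not> int p dvd b * d"
    have "[rat_residue p (q + r) * (b * d) = a * d + c * b] (mod int p)"
      unfolding sum using p nd by (rule rat_residue_cong)
    moreover have "[rat_residue p q * b * d + rat_residue p r * d * b = a * d + c * b] (mod int p)"
      unfolding q r using not_prime_dvd_mult[OF p nd]
      by (intro cong_add cong_mult cong_refl rat_residue_cong p) auto
    ultimately have "[rat_residue p (q + r) * (b * d) =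
        rat_residue p q * b * d + rat_residue p r * d * b] (mod int p)"
      by (metis cong_sym cong_trans)
    from cong_mult[OF this cong_refl[of "f p"]]
    show "[rat_residue p (q + r) * f p * (b * d) =
        (rat_residue p q * f p + rat_residue p r * f p) * (b * d)] (mod int p)"
      by (simp add: algebra_simps)
  qed (use q r in auto)
  show "q *\<^sub>A r *\<^sub>A x = (q * r) *\<^sub>A x"
  proof (transfer fixing: q r, rule eq_almost_all_primesI[of "b * d"])
    fix f :: "nat \<Rightarrow> int" and p :: nat assume p: "prime p" and nd: "\<not> int p dvd b * d"
    have "[rat_residue p (q * r) * (b * d) = a * c] (mod int p)"
      unfolding prod using p nd by (rule rat_residue_cong)
    moreover have "[(rat_residue p q * b) * (rat_residue p r * d) = a * c] (mod int p)"
      unfolding q r using not_prime_dvd_mult[OF p nd]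
      by (intro cong_mult rat_residue_cong p) auto
    ultimately have "[(rat_residue p q * b) * (rat_residue p r * d) =
        rat_residue p (q * r) * (b * d)] (mod int p)"
      by (metis cong_sym cong_trans)
    from cong_mult[OF this cong_refl[of "f p"]]
    show "[rat_residue p q * (rat_residue p r * f p) * (b * d) =
        rat_residue p (q * r) * f p * (b * d)] (mod int p)"
      by (simp add: mult_ac)
  qed (use q r in auto)
  show "1 *\<^sub>A x = x"
  proof (transfer, rule eq_almost_all_primesI[of 1])
    fix f :: "nat \<Rightarrow> int" and p :: nat assume "prime p" "\<not> int p dvd 1"
    from rat_residue_cong[OF this, of 1] show "[rat_residue p 1 * f p * 1 = f p * 1] (mod int p)"
      using cong_mult[OF _ cong_refl[of "f p"], of "rat_residue p 1" 1 "int p"] by simp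
  qed simp
qed

lemma scale_A_mult_left: "(q *\<^sub>A x) * y = q *\<^sub>A (x * y)"
  by transfer (simp add: mult_ac eq_almost_all_primes_refl)

text \<open>
  The class of \<open>(x p mod p)\<close>, for rational \<open>x p\<close>. This is meaningful when \<open>p\<close> does not divide
  the denominator of \<open>x p\<close> for all but finitely many primes \<open>p\<close>.
\<close>

lift_definition class_A :: "(nat \<Rightarrow> rat) \<Rightarrow> ring_A" is "\<lambda>x p. rat_residue p (x p)" .

text \<open>
  The list \<open>n\<close> holds \<open>n\<^sub>1, \<dots>, n\<^sub>d\<close>; as \<open>n ! j\<close> is \<open>n\<^sub>j\<^sub>+\<^sub>1\<close>, the parity condition
  \<open>n\<^sub>j \<equiv> d - j + 1\<close> becomes \<open>n ! j \<equiv> d - j\<close>.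
\<close>

definition T_indices :: "nat \<Rightarrow> nat \<Rightarrow> nat list set" where
  "T_indices d p = {n. length n = d \<and> sorted_wrt (>) n \<and>
     (\<forall>j<d. 0 < n ! j \<and> n ! j < p \<and> [n ! j = d - j] (mod 2))}"

definition T_A :: "nat list \<Rightarrow> ring_A" where
  "T_A s = class_A (\<lambda>p. \<Sum>n\<in>T_indices (length s) p.
     2 ^ length s / (\<Prod>j<length s. of_nat (n ! j) ^ (s ! j)))"

lemma finite_T_indices: "finite (T_indices d p)"
proof (rule finite_subset)
  show "T_indices d p \<subseteq> {n. set n \<subseteq> {..<p} \<and> length n = d}"
    by (auto simp: T_indices_def in_set_conv_nth)
  show "finite {n. set n \<subseteq> {..<p} \<and> length n = d}"
    by (rule finite_lists_length_eq) simp
qed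

definition bernoulli_number :: "nat \<Rightarrow> rat" where
  "bernoulli_number n = fact n * fps_nth (fps_X / (fps_exp 1 - 1)) n"

lemma bernoulli_number_generating_function:
  "(fps_exp 1 - 1) * Abs_fps (\<lambda>n. bernoulli_number n / fact n) = fps_X"
proof -
  have sub: "subdegree (fps_exp 1 - 1 :: rat fps) = 1"
    by (rule subdegreeI) auto
  hence "(fps_exp 1 - 1 :: rat fps) dvd fps_X"
    by (subst fps_dvd_iff) (auto simp: fps_X_neq_zero dest: arg_cong[of _ _ subdegree])
  moreover have "Abs_fps (\<lambda>n. bernoulli_number n / fact n) = fps_X / (fps_exp 1 - 1)"
    by (simp add: fps_eq_iff bernoulli_number_def)
  ultimately show ?thesis by simp
qed

definition beta_A :: "nat \<Rightarrow> ring_A" where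
  "beta_A m = class_A (\<lambda>p. if p > m then bernoulli_number (p - m) / of_nat m else 0)"

end

theory Submission
  imports Defs
begin

text \<open>
  Fix a large prime \<open>p\<close>. The series \<open>T_fps s\<close>, obtained by sorting the terms of \<open>T\<^sub>\<A>(s)\<close> by
  their largest index, is an iterated integral in the forms \<open>2 dz / (1 - z\<^sup>2)\<close> and \<open>dz / z\<close>. In
  particular \<open>T_log = T_fps [1]\<close> is the logarithm of \<open>(1 + z) / (1 - z)\<close>, and \<open>{1}\<^sup>d\<close> gives its
  divided powers. Three consequences of this carry the proof.

  First, iterated integrals multiply by shuffling. The coefficient of \<open>z\<^sup>p\<close> in a product of two
  such series is \<open>p\<close>-integral, whereas in a single series \<open>T_fps (1 # s)\<close>, with \<open>s\<close> of even length, it is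
  \<open>2 / p\<close> times the finite sum for \<open>s\<close>. Multiplying by the logarithm therefore relates, for odd \<open>k\<close>, the
  finite sums for \<open>({1}\<^sup>l, 2, {1}\<^sup>k\<^sup>-\<^sup>l)\<close> with neighbouring \<open>l\<close> (\<open>T_trunc_move_two\<close>), and the one for
  \<open>l = 0\<close> with the coefficient of \<open>z\<^sup>p\<close> in \<open>T_log\<^sup>k\<^sup>+\<^sup>2\<close> (\<open>T_trunc_two_ones\<close>).

  Second, \<open>2 sinh(T_log) = 4 z / (1 - z\<^sup>2) = 2 z T_log'\<close>. Multiplied by powers of \<open>T_log\<close> and read at
  \<open>z\<^sup>p\<close>, this is modulo \<open>p\<close> the recurrence for the coefficients of \<open>x / sinh x\<close>, which are
  multiples of Bernoulli numbers (\<open>T_log_power_p_cong\<close>). This settles all odd \<open>k\<close>; the depth one sum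
  \<open>T\<^sub>\<A>(k + 2)\<close> comes from the generating function of odd power sums, in which the same series
  occurs (\<open>T_trunc_single_bernoulli\<close>).

  Third, the sums for \<open>(2, {1}\<^sup>k)\<close> are the coefficients of the polynomial
  \<open>S(t) = \<Sum>\<^sub>0\<^sub><\<^sub>n\<^sub><\<^sub>p g\<^sub>n(t) / n\<close>, where \<open>((1 + z) / (1 - z))\<^sup>t = \<Sum> g\<^sub>n(t) z\<^sup>n\<close>. Its difference
  \<open>S(t + 1) - S(t - 1)\<close> is \<open>(2 / t) \<Sum>\<^sub>0\<^sub><\<^sub>n\<^sub><\<^sub>p g\<^sub>n(t)\<close>, which is \<open>2 ((-1)\<^sup>t - 1) / t\<close> modulo \<open>p\<close> for
  \<open>0 < t < p\<close>. As \<open>S(0) = 0\<close>, and \<open>S(1)\<close> is a harmonic sum that vanishes modulo \<open>p\<close>,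
  the polynomial \<open>S\<close> vanishes at odd residues and is \<open>-4\<close> times a sum of reciprocals of odd numbers
  at even ones. Recovering the coefficients from the values (\<open>coefficient_from_values\<close>)
  gives a double sum, which the substitution \<open>n \<mapsto> p - n\<close> identifies with \<open>T\<^sub>\<A>(1, k + 1)\<close> (\<open>T_trunc_two_ones_reversal\<close>).
\<close>

section \<open>Congruences between rational numbers modulo a prime\<close>

text \<open>
  The denominator is only required to be coprime to \<open>p\<close>, not in lowest terms. In this form
  sums and products preserve integrality for every \<open>p\<close>, prime or not.
\<close>

definition p_integral :: "nat \<Rightarrow> rat \<Rightarrow> bool" where
  "p_integral p x \<longleftrightarrow> (\<exists>a b. x = of_int a / of_int b \<and> b > 0 \<and> coprime b (int p))"

text \<open>
  Integrality of both sides is part of the relation, which makes it multiplicative without side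
  conditions.
\<close>

definition p_cong :: "nat \<Rightarrow> rat \<Rightarrow> rat \<Rightarrow> bool" where
  "p_cong p x y \<longleftrightarrow> p_integral p x \<and> p_integral p y \<and>
     (\<exists>r. p_integral p r \<and> x - y = of_nat p * r)"

lemma p_integral_int [simp]: "p_integral p (of_int a)"
  unfolding p_integral_def by (intro exI[of _ a] exI[of _ 1]) simp

lemma p_integral_nat [simp]: "p_integral p (of_nat n)"
  using p_integral_int[of p "int n"] by simp

lemma p_integral_0 [simp]: "p_integral p 0"
  using p_integral_int[of p 0] by simp

lemma p_integral_1 [simp]: "p_integral p 1"
  using p_integral_int[of p 1] by simp

lemma p_integral_numeral [simp]: "p_integral p (numeral n)"
  using p_integral_int[of p "numeral n"] by simp

lemma p_integral_fact [simp]: "p_integral p (fact n)"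
  using p_integral_nat[of p "fact n"] by simp

lemma p_integral_add:
  assumes "p_integral p x" "p_integral p y" shows "p_integral p (x + y)"
proof -
  obtain a b c d where x: "x = of_int a / of_int b" "b > 0" "coprime b (int p)"
    and y: "y = of_int c / of_int d" "d > 0" "coprime d (int p)"
    using assms unfolding p_integral_def by blast
  have "x + y = of_int (a * d + c * b) / of_int (b * d)"
    using x y by (simp add: field_simps)
  moreover have "b * d > 0" "coprime (b * d) (int p)"
    using x y by simp_all
  ultimately show ?thesis unfolding p_integral_def by blast
qed

lemma p_integral_mult:
  assumes "p_integral p x" "p_integral p y" shows "p_integral p (x * y)"
proof -
  obtain a b c d where x: "x = of_int a / of_int b" "b > 0" "coprime b (int p)"
    and y: "y = of_int c / of_int d" "d > 0" "coprime d (int p)"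
    using assms unfolding p_integral_def by blast
  have "x * y = of_int (a * c) / of_int (b * d)"
    using x y by simp
  moreover have "b * d > 0" "coprime (b * d) (int p)"
    using x y by simp_all
  ultimately show ?thesis unfolding p_integral_def by blast
qed

lemma p_integral_minus: "p_integral p x \<Longrightarrow> p_integral p (- x)"
  using p_integral_mult[OF p_integral_int[of p "-1"]] by simp

lemma p_integral_diff: "p_integral p x \<Longrightarrow> p_integral p y \<Longrightarrow> p_integral p (x - y)"
  using p_integral_add[OF _ p_integral_minus, of p x y] by simp

lemma p_integral_power: "p_integral p x \<Longrightarrow> p_integral p (x ^ n)"
  by (induction n) (auto intro: p_integral_mult)

lemma p_integral_sum: "(\<And>i. i \<in> A \<Longrightarrow> p_integral p (f i)) \<Longrightarrow> p_integral p (sum f A)"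
  by (induction A rule: infinite_finite_induct) (auto intro: p_integral_add)

lemmas p_integral_intros = p_integral_int p_integral_nat p_integral_0 p_integral_1
  p_integral_numeral p_integral_add p_integral_mult p_integral_minus p_integral_diff
  p_integral_power p_integral_sum

lemma p_cong_refl [simp]: "p_integral p x \<Longrightarrow> p_cong p x x"
  unfolding p_cong_def by (intro conjI exI[of _ 0]) auto

lemma p_cong_sym: assumes "p_cong p x y" shows "p_cong p y x"
proof -
  obtain r where "p_integral p r" "x - y = of_nat p * r"
    using assms unfolding p_cong_def by blast
  then have "p_integral p (- r)" "y - x = of_nat p * (- r)"
    by (auto simp: algebra_simps intro: p_integral_minus)
  then show ?thesis using assms unfolding p_cong_def by blast
qed

lemma p_cong_trans [trans]:
  assumes "p_cong p x y" "p_cong p y z" shows "p_cong p x z"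
proof -
  obtain r s where "p_integral p r" "x - y = of_nat p * r" "p_integral p s" "y - z = of_nat p * s"
    using assms unfolding p_cong_def by blast
  then have "p_integral p (r + s)" "x - z = of_nat p * (r + s)"
    by (auto simp: algebra_simps intro: p_integral_add)
  then show ?thesis using assms unfolding p_cong_def by blast
qed

lemma p_cong_add:
  assumes "p_cong p x y" "p_cong p x' y'" shows "p_cong p (x + x') (y + y')"
proof -
  obtain r s where "p_integral p r" "x - y = of_nat p * r" "p_integral p s" "x' - y' = of_nat p * s"
    using assms unfolding p_cong_def by blast
  then have "p_integral p (r + s)" "(x + x') - (y + y') = of_nat p * (r + s)"
    by (auto simp: algebra_simps intro: p_integral_add)
  then show ?thesis using assms p_integral_add unfolding p_cong_def by blast
qed

lemma p_cong_mult:
  assumes "p_cong p x y" "p_cong p x' y'" shows "p_cong p (x * x') (y * y')"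
proof -
  obtain r s where rs: "p_integral p r" "x - y = of_nat p * r" "p_integral p s" "x' - y' = of_nat p * s"
    using assms unfolding p_cong_def by blast
  have "x * x' - y * y' = (x - y) * x' + y * (x' - y')" by (simp add: algebra_simps)
  also have "\<dots> = of_nat p * (r * x' + y * s)" unfolding rs by (simp add: algebra_simps)
  finally have "x * x' - y * y' = of_nat p * (r * x' + y * s)" .
  moreover have "p_integral p (r * x' + y * s)" "p_integral p (x * x')" "p_integral p (y * y')"
    using rs assms by (auto simp only: p_cong_def intro: p_integral_add p_integral_mult)
  ultimately show ?thesis unfolding p_cong_def by blast
qed

lemma p_cong_mult_left: "p_integral p z \<Longrightarrow> p_cong p x y \<Longrightarrow> p_cong p (z * x) (z * y)"
  by (intro p_cong_mult p_cong_refl)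

lemma p_cong_minus: "p_cong p x y \<Longrightarrow> p_cong p (- x) (- y)"
  using p_cong_mult[OF p_cong_refl[OF p_integral_int[of p "-1"]]] by simp

lemma p_cong_diff: "p_cong p x y \<Longrightarrow> p_cong p x' y' \<Longrightarrow> p_cong p (x - x') (y - y')"
  using p_cong_add[OF _ p_cong_minus, of p x y x' y'] by simp

lemma p_cong_power: "p_cong p x y \<Longrightarrow> p_cong p (x ^ n) (y ^ n)"
  by (induction n) (auto intro: p_cong_mult)

lemma p_cong_sum:
  "(\<And>i. i \<in> A \<Longrightarrow> p_cong p (f i) (g i)) \<Longrightarrow> p_cong p (sum f A) (sum g A)"
  by (induction A rule: infinite_finite_induct) (auto intro: p_cong_add)

lemma p_cong_p_mult: "p_integral p r \<Longrightarrow> p_cong p (of_nat p * r) 0"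
  unfolding p_cong_def by (auto intro: p_integral_mult)

lemma p_cong_of_int: "[a = b] (mod int p) \<Longrightarrow> p_cong p (of_int a) (of_int b)"
proof -
  assume "[a = b] (mod int p)"
  then obtain k where "a - b = int p * k" by (auto simp: cong_iff_dvd_diff)
  then have "(of_int a - of_int b :: rat) = of_nat p * of_int k"
    by (metis of_int_diff of_int_mult of_int_of_nat_eq)
  then show ?thesis unfolding p_cong_def by (intro conjI exI[of _ "of_int k"] p_integral_int)
qed

context
  fixes p :: nat
  assumes p: "prime p"
begin

lemma p_integral_inverse_nat:
  assumes "0 < n" "n < p" shows "p_integral p (1 / of_nat n)"
proof -
  have "coprime n p"
    using assms p by (metis coprime_commute nat_dvd_not_less prime_imp_coprime)
  then show ?thesis
    unfolding p_integral_def using assms by (intro exI[of _ 1] exI[of _ "int n"]) auto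
qed

lemma p_integral_div_nat:
  assumes "p_integral p x" "0 < n" "n < p" shows "p_integral p (x / of_nat n)"
  using p_integral_mult[OF assms(1) p_integral_inverse_nat[OF assms(2,3)]] by simp

lemma p_integral_inverse_fact: "n < p \<Longrightarrow> p_integral p (1 / fact n)"
proof (induction n)
  case (Suc n)
  have "p_integral p ((1 / fact n) * (1 / of_nat (Suc n)))"
    using Suc by (intro p_integral_mult p_integral_inverse_nat Suc.IH) auto
  then show ?case by (simp add: field_simps)
qed simp

lemma p_cong_div_nat:
  "p_cong p x y \<Longrightarrow> 0 < n \<Longrightarrow> n < p \<Longrightarrow> p_cong p (x / of_nat n) (y / of_nat n)"
  using p_cong_mult[OF _ p_cong_refl[OF p_integral_inverse_nat], of x y n] by simp

lemma p_cong_mult_nat_cancel: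
  "p_cong p (of_nat n * x) (of_nat n * y) \<Longrightarrow> 0 < n \<Longrightarrow> n < p \<Longrightarrow> p_cong p x y"
  using p_cong_div_nat[of "of_nat n * x" "of_nat n * y" n] by simp

lemma p_cong_fermat: assumes "0 < a" "a < p" shows "p_cong p (of_nat a ^ (p - 1)) 1"
proof -
  have "\<not> p dvd a" using assms by (auto dest: dvd_imp_le)
  then have "[a ^ (p - 1) = 1] (mod p)" by (rule fermat_theorem[OF p])
  then have "[int (a ^ (p - 1)) = int 1] (mod int p)" by (simp only: cong_int_iff)
  from p_cong_of_int[OF this] show ?thesis by simp
qed

lemma p_cong_reflect: "n \<le> p \<Longrightarrow> p_cong p (of_nat (p - n)) (- of_nat n)"
  using p_cong_of_int[of _ _ p, of "int (p - n)" "- int n"] by (auto simp: cong_iff_dvd_diff of_nat_diff)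

lemma p_cong_inverse_reflect:
  assumes "0 < n" "n < p" shows "p_cong p (1 / of_nat (p - n)) (- (1 / of_nat n))"
proof -
  have "p_cong p (of_nat (p - n) * ((1 / of_nat n) * (1 / of_nat (p - n))))
      (- of_nat n * ((1 / of_nat n) * (1 / of_nat (p - n))))"
    using assms by (intro p_cong_mult[OF p_cong_reflect] p_cong_refl p_integral_mult
        p_integral_inverse_nat) auto
  then have "p_cong p (1 / of_nat n) (- (1 / of_nat (p - n)))"
    using assms by simp
  from p_cong_minus[OF p_cong_sym[OF this]] show ?thesis by simp
qed

text \<open>
  Negative powers become polynomial expressions: this is what turns truncated harmonic sums into
  power sums.
\<close>

lemma p_cong_inverse_power:
  assumes "0 < a" "a < p" "j \<le> p - 1"
  shows "p_cong p (of_nat a ^ (p - 1 - j)) (1 / of_nat a ^ j)"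
proof -
  have "p_cong p (of_nat a ^ (p - 1) * (1 / of_nat a) ^ j) (1 * (1 / of_nat a) ^ j)"
    using assms by (intro p_cong_mult p_cong_fermat p_cong_refl p_integral_power
        p_integral_inverse_nat)
  moreover have "of_nat a ^ (p - 1) * (1 / of_nat a :: rat) ^ j = of_nat a ^ (p - 1 - j)"
    using assms by (simp add: power_diff power_one_over field_simps)
  ultimately show ?thesis by (simp add: power_one_over)
qed

lemma p_cong_wilson: "p_cong p (fact (p - 1)) (- 1)"
  using p_cong_of_int[OF wilson_theorem[OF p]] by simp

text \<open>
  Starting from Wilson's theorem at \<open>m = 0\<close>, each step trades a factor \<open>p - m\<close> of the first
  factorial for a factor \<open>m\<close> of the second, at the cost of a sign.
\<close>

lemma fact_reflect:
  "m < p \<Longrightarrow> p_cong p (fact (p - 1 - m) * fact m) ((- 1) ^ Suc m)"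
proof (induction m)
  case 0
  then show ?case using p_cong_wilson by simp
next
  case (Suc m)
  have "p_cong p (fact (p - 1 - Suc m) * fact m * of_nat (Suc m)) (fact (p - 1 - Suc m) * fact m * (- of_nat (p - Suc m)))"
    using p_cong_minus[OF p_cong_sym[OF p_cong_reflect[of "Suc m"]]] Suc.prems
    by (intro p_cong_mult_left p_integral_mult p_integral_fact) (simp del: of_nat_Suc of_nat_diff)
  also have "fact (p - 1 - Suc m) * fact m * (- of_nat (p - Suc m)) = - (fact (p - 1 - m) * fact m :: rat)"
  proof -
    have "p - 1 - m = Suc (p - 1 - Suc m)" "p - Suc m = Suc (p - 1 - Suc m)" using Suc.prems by auto
    then show ?thesis by (simp only: fact_Suc) (simp add: algebra_simps)
  qed
  also have "p_cong p \<dots> (- ((- 1) ^ Suc m))"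
    using Suc by (intro p_cong_minus) auto
  finally show ?case by (simp add: algebra_simps)
qed

end

section \<open>Power sums and polynomials modulo a prime\<close>

context
  fixes p :: nat
  assumes p: "prime p"
begin

lemma p_cong_0_p_power: "p_cong p (of_nat p ^ Suc n) 0"
  using p_cong_p_mult[OF p_integral_power[OF p_integral_nat[of p p]]] by simp

text \<open>
  Summing \<open>(a + 1)\<^sup>m\<^sup>+\<^sup>1 - a\<^sup>m\<^sup>+\<^sup>1\<close> over a full period telescopes to a power of \<open>p\<close>; expanding the
  binomial, all power sums of lower exponent vanish by induction, and \<open>m + 1\<close> is invertible.
\<close>

lemma power_sum_p_cong_0:
  "m < p - 1 \<Longrightarrow> p_cong p (\<Sum>a<p. of_nat a ^ m) 0"
proof (induction m rule: less_induct)
  case (less m)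
  have "(\<Sum>i\<le>m. of_nat (Suc m choose i) * (\<Sum>a<p. of_nat a ^ i)) =
      (\<Sum>a<p. \<Sum>i\<le>m. of_nat (Suc m choose i) * (of_nat a :: rat) ^ i)"
    by (simp add: sum_distrib_left sum.swap[of _ "{..m}"])
  also have "\<dots> = (\<Sum>a<p. of_nat (Suc a) ^ Suc m - of_nat a ^ Suc m)"
  proof (rule sum.cong[OF refl])
    fix a
    show "(\<Sum>i\<le>m. of_nat (Suc m choose i) * (of_nat a :: rat) ^ i) = of_nat (Suc a) ^ Suc m - of_nat a ^ Suc m"
      using binomial_ring[of "of_nat a :: rat" 1 "Suc m"] by (simp add: add.commute del: power_Suc)
  qed
  also have "\<dots> = of_nat p ^ Suc m"
    by (subst sum_lessThan_telescope) simp
  finally have "of_nat (Suc m) * (\<Sum>a<p. of_nat a ^ m) =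
      (of_nat p ^ Suc m - (\<Sum>i<m. of_nat (Suc m choose i) * (\<Sum>a<p. of_nat a ^ i)) :: rat)"
    by (simp add: lessThan_Suc_atMost[symmetric])
  also have "p_cong p \<dots> (0 - (\<Sum>i<m. of_nat (Suc m choose i) * 0))"
    using less by (intro p_cong_diff p_cong_0_p_power p_cong_sum p_cong_mult_left less.IH) (auto simp: p)
  finally have "p_cong p (of_nat (Suc m) * (\<Sum>a<p. of_nat a ^ m)) (of_nat (Suc m) * 0)" by simp
  then show ?case by (rule p_cong_mult_nat_cancel[OF p]) (use less.prems in auto)
qed

lemma power_sum_positive_p_cong_0:
  assumes "0 < m" "m < p - 1"
  shows "p_cong p (\<Sum>a=1..<p. of_nat a ^ m) 0"
proof -
  have "(\<Sum>a<p. of_nat a ^ m) = (\<Sum>a=1..<p. (of_nat a :: rat) ^ m)"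
    using assms by (intro sum.mono_neutral_right) auto
  with power_sum_p_cong_0[OF assms(2)] show ?thesis by simp
qed

text \<open>
  Discrete Fourier inversion on the cyclic group of nonzero residues: a polynomial of degree
  below \<open>p\<close> without constant term can be read off modulo \<open>p\<close> from its values at \<open>1, \<dots>, p - 1\<close>,
  since the sum of \<open>a\<^sup>m\<close> over these residues vanishes unless \<open>p - 1\<close> divides \<open>m\<close>. The bound
  \<open>j < p - 1\<close> excludes the one exponent that has the same values as the constant term.
\<close>

lemma coefficient_from_values:
  assumes s: "\<And>d. d \<in> {1..<p} \<Longrightarrow> p_integral p (s d)" and j: "0 < j" "j < p - 1"
  shows "p_cong p (\<Sum>a=1..<p. of_nat a ^ (p - 1 - j) * (\<Sum>d=1..<p. s d * of_nat a ^ d)) (- s j)"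
proof -
  let ?P = "\<lambda>d. \<Sum>a=1..<p. (of_nat a :: rat) ^ (p - 1 - j + d)"
  have P: "p_cong p (?P d) (if d = j then -1 else 0)" if d: "d \<in> {1..<p}" for d
  proof -
    consider "d < j" | "d = j" | "d > j" by linarith
    then show ?thesis
    proof cases
      case 1
      then show ?thesis using power_sum_positive_p_cong_0[of "p - 1 - j + d"] j d by auto
    next
      case 2
      have "p_cong p (?P d) (\<Sum>a=1..<p. 1)"
        using 2 j p_cong_fermat[OF p] by (intro p_cong_sum) auto
      also have "(\<Sum>a=1..<p. 1 :: rat) = of_nat (p - 1)" by simp
      also have "p_cong p (of_nat (p - 1)) (- of_nat 1)"
        using p_cong_reflect[OF p, of 1] prime_gt_1_nat[OF p] by simp
      finally show ?thesis using 2 by (simp add: p_cong_trans)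
    next
      case 3
      have "p_cong p (?P d) (\<Sum>a=1..<p. 1 * of_nat a ^ (d - j))"
      proof (intro p_cong_sum)
        fix a assume a: "a \<in> {1..<p}"
        have "(of_nat a :: rat) ^ (p - 1 - j + d) = of_nat a ^ (p - 1) * of_nat a ^ (d - j)"
          using 3 j by (simp flip: power_add)
        then show "p_cong p (of_nat a ^ (p - 1 - j + d)) (1 * of_nat a ^ (d - j))"
          using a p_cong_mult[OF p_cong_fermat[OF p, of a] p_cong_refl[OF p_integral_power]]
          by simp
      qed
      also have "p_cong p \<dots> 0"
        using power_sum_positive_p_cong_0[of "d - j"] 3 j d by auto
      finally show ?thesis using 3 by (simp add: p_cong_trans)
    qed
  qed
  have "(\<Sum>a=1..<p. of_nat a ^ (p - 1 - j) * (\<Sum>d=1..<p. s d * of_nat a ^ d)) = (\<Sum>d=1..<p. s d * ?P d)"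
    unfolding sum_distrib_left by (subst sum.swap) (simp add: power_add mult_ac)
  also have "p_cong p \<dots> (\<Sum>d=1..<p. s d * (if d = j then -1 else 0))"
    by (intro p_cong_sum p_cong_mult_left P s)
  also have "(\<Sum>d=1..<p. s d * (if d = j then -1 else 0)) = - s j"
    using j by (simp add: if_distrib cong: if_cong)
  finally show ?thesis .
qed

end

section \<open>Equality of classes of rational families\<close>

lemma coprime_imp_not_prime_dvd:
  assumes "prime p" "coprime b (int p)" shows "\<not> int p dvd b"
  using assms by (meson coprime_common_divisor dvd_refl not_prime_unit prime_int_nat_transfer prime_nat_int_transfer)

lemma rat_residue_p_cong:
  assumes "prime p" "p_cong p x y"
  shows "[rat_residue p x = rat_residue p y] (mod int p)"
proof -
  obtain a b c d r where x: "x = of_int a / of_int b" "b > 0" "coprime b (int p)"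
    and y: "y = of_int c / of_int d" "d > 0" "coprime d (int p)"
    and "p_integral p r" and xy: "x - y = of_nat p * r"
    using assms(2) unfolding p_cong_def p_integral_def by blast
  then obtain e f where r: "r = of_int e / of_int f" "f > 0" "coprime f (int p)"
    unfolding p_integral_def by blast
  have nz: "b \<noteq> 0" "d \<noteq> 0" "f \<noteq> 0" using x y r by auto
  have cop: "coprime (b * d * f) (int p)"
    using x y r by simp
  note nd = coprime_imp_not_prime_dvd[OF assms(1)]
  have "of_int ((a * d - c * b) * f) = (of_int (int p * (e * (b * d))) :: rat)"
    using xy nz unfolding x y r by (simp add: field_simps)
  then have eq: "(a * d - c * b) * f = int p * (e * (b * d))" by (simp only: of_int_eq_iff)
  have "[(a * d) * f = (c * b) * f] (mod int p)"
    unfolding cong_iff_dvd_diff using eq by (metis dvd_triv_left left_diff_distrib)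
  moreover have "[rat_residue p x * b * (d * f) = a * (d * f)] (mod int p)"
    unfolding x by (intro cong_mult cong_refl rat_residue_cong assms nd x)
  moreover have "[rat_residue p y * d * (b * f) = c * (b * f)] (mod int p)"
    unfolding y by (intro cong_mult cong_refl rat_residue_cong assms nd y)
  ultimately have "[rat_residue p x * (b * d * f) = rat_residue p y * (b * d * f)] (mod int p)"
    by (simp add: mult_ac) (metis cong_sym cong_trans)
  then show ?thesis using cop by (simp add: cong_mult_rcancel)
qed

lemma rat_residue_mult:
  assumes p: "prime p" "p_integral p q" "p_integral p x"
  shows "[rat_residue p (q * x) = rat_residue p q * rat_residue p x] (mod int p)"
proof -
  obtain a b c d where q: "q = of_int a / of_int b" "b > 0" "coprime b (int p)"
    and x: "x = of_int c / of_int d" "d > 0" "coprime d (int p)"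
    using assms unfolding p_integral_def by blast
  have cop: "coprime (b * d) (int p)"
    using x q by simp
  have qx: "q * x = of_int (a * c) / of_int (b * d)" using q x by simp
  note nd = coprime_imp_not_prime_dvd[OF p(1)]
  have "[rat_residue p (q * x) * (b * d) = a * c] (mod int p)"
    unfolding qx by (intro rat_residue_cong p nd cop)
  moreover have "[(rat_residue p q * b) * (rat_residue p x * d) = a * c] (mod int p)"
    unfolding q x by (intro cong_mult rat_residue_cong p nd x q)
  ultimately have "[rat_residue p (q * x) * (b * d) = (rat_residue p q * rat_residue p x) * (b * d)] (mod int p)"
    by (simp add: mult_ac) (metis cong_sym cong_trans)
  then show ?thesis using cop by (simp add: cong_mult_rcancel)
qed

lemma finite_primes_not_p_integral: "finite {p. prime p \<and> \<not> p_integral p q}"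
proof -
  obtain a b where q: "q = of_int a / of_int b" "b > 0"
    by (metis prod.exhaust quotient_of_denom_pos quotient_of_div)
  have "coprime b (int p)" if "prime p" "\<not> int p dvd b" for p
    using that by (metis coprime_commute prime_imp_coprime prime_nat_int_transfer)
  then have "p_integral p q" if "prime p" "\<not> int p dvd b" for p
    using that q unfolding p_integral_def by blast
  then have "{p. prime p \<and> \<not> p_integral p q} \<subseteq> {p. prime p \<and> int p dvd b}"
    by blast
  then show ?thesis using finite_primes_dvd[of b] q(2) finite_subset by (metis less_irrefl)
qed

text \<open>
  Scalars are admitted on both sides because a rational factor is defined on \<open>\<A>\<close> only through
  its residues; the finitely many primes that divide a denominator are discarded here, so that all
  later arguments concern one sufficiently large prime.
\<close>

lemma scale_class_A_eqI:
  assumes "\<And>p. prime p \<Longrightarrow> M < p \<Longrightarrow> p_integral p q \<Longrightarrow> p_integral p r \<Longrightarrow>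
     p_integral p (x p) \<and> p_integral p (y p) \<and> p_cong p (q * x p) (r * y p)"
  shows "q *\<^sub>A class_A x = r *\<^sub>A class_A y"
proof (transfer fixing: q r x y)
  have "[rat_residue p q * rat_residue p (x p) = rat_residue p r * rat_residue p (y p)] (mod int p)"
    if "prime p" "M < p" "p_integral p q" "p_integral p r" for p
  proof -
    have *: "p_integral p (x p)" "p_integral p (y p)" "p_cong p (q * x p) (r * y p)"
      using assms[OF that] by auto
    show ?thesis
      using rat_residue_mult[OF that(1,3) *(1)] rat_residue_mult[OF that(1,4) *(2)]
        rat_residue_p_cong[OF that(1) *(3)] by (meson cong_sym cong_trans)
  qed
  then have "{p. prime p \<and> \<not> [rat_residue p q * rat_residue p (x p) = rat_residue p r * rat_residue p (y p)] (mod int p)}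
     \<subseteq> {..M} \<union> {p. prime p \<and> \<not> p_integral p q} \<union> {p. prime p \<and> \<not> p_integral p r}"
    by (auto simp: not_le)
  then show "eq_almost_all_primes (\<lambda>p. rat_residue p q * rat_residue p (x p)) (\<lambda>p. rat_residue p r * rat_residue p (y p))"
    unfolding eq_almost_all_primes_def
    by (rule finite_subset) (auto simp: finite_primes_not_p_integral)
qed

section \<open>Truncated sums and iterated integrals\<close>

text \<open>
  The part of the sum for \<open>T\<^sub>\<A>(s)\<close> in which the largest index equals \<open>n\<close>; it is also the \<open>n\<close>-th
  Taylor coefficient of the iterated integral attached to \<open>s\<close>. The
  parity pattern builds up along the recursion: the coefficients for \<open>s\<close> vanish at all indices
  of the wrong parity.
\<close>

fun T_coeff :: "nat list \<Rightarrow> nat \<Rightarrow> rat" where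
  "T_coeff [] n = (if n = 0 then 1 else 0)"
| "T_coeff (a # s) n =
     (if n > 0 \<and> odd (n + length s) then 2 / of_nat n ^ a * (\<Sum>m<n. T_coeff s m) else 0)"

definition T_trunc :: "nat list \<Rightarrow> nat \<Rightarrow> rat" where
  "T_trunc s p = (\<Sum>n<p. T_coeff s n)"

lemma T_coeff_parity: "odd (n + length s) \<Longrightarrow> T_coeff s n = 0"
  by (cases s) (auto intro: Nat.gr0I)

lemma T_indices_0: "T_indices 0 p = {[]}"
  by (auto simp: T_indices_def)

text \<open>
  Splitting off the largest index reduces the depth while keeping the parity pattern, because the
  parities are prescribed by the distance from the smallest index.
\<close>

lemma T_indices_Suc:
  "T_indices (Suc d) p =
     (\<lambda>(m, n). m # n) ` (SIGMA m:{m. 0 < m \<and> m < p \<and> odd (m + d)}. T_indices d m)"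
  (is "_ = ?R")
proof (intro equalityI subsetI)
  fix ns assume ns: "ns \<in> T_indices (Suc d) p"
  then obtain m n where mn: "ns = m # n" by (cases ns) (auto simp: T_indices_def)
  have len: "length n = d" and srt: "sorted_wrt (>) (m # n)"
    and idx: "\<And>j. j < Suc d \<Longrightarrow> 0 < (m # n) ! j \<and> (m # n) ! j < p \<and> [(m # n) ! j = Suc d - j] (mod 2)"
    using ns mn by (auto simp: T_indices_def)
  have "0 < m \<and> m < p \<and> odd (m + d)"
    using idx[of 0] by (auto simp: Cong.cong_def)
  moreover have "n \<in> T_indices d m"
    unfolding T_indices_def
  proof (intro CollectI conjI allI impI)
    fix j assume j: "j < d"
    show "0 < n ! j" "[n ! j = d - j] (mod 2)" using idx[of "Suc j"] j by auto
    show "n ! j < m" using srt len j by simp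
  qed (use len srt in auto)
  ultimately show "ns \<in> ?R" using mn by force
next
  fix ns assume "ns \<in> ?R"
  then obtain m n where mn: "ns = m # n" "0 < m" "m < p" "odd (m + d)" "n \<in> T_indices d m"
    by auto
  have "sorted_wrt (>) (m # n)"
    using mn(5) by (auto simp: T_indices_def in_set_conv_nth)
  moreover have "0 < (m # n) ! j \<and> (m # n) ! j < p \<and> [(m # n) ! j = Suc d - j] (mod 2)"
    if "j < Suc d" for j
  proof (cases j)
    case 0
    then show ?thesis using mn by (auto simp: Cong.cong_def)
  next
    case (Suc i)
    then show ?thesis using mn that by (auto simp: T_indices_def intro: less_trans)
  qed
  ultimately show "ns \<in> T_indices (Suc d) p"
    using mn by (auto simp: T_indices_def)
qed

lemma sum_T_indices:
  "(\<Sum>n\<in>T_indices (length s) p. 2 ^ length s / (\<Prod>j<length s. of_nat (n ! j) ^ (s ! j))) =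
     (if s = [] then 1 else T_trunc s p)"
proof (induction s arbitrary: p)
  case Nil
  show ?case by (simp add: T_indices_0)
next
  case (Cons a s)
  let ?f = "\<lambda>s n. 2 ^ length s / (\<Prod>j<length s. of_nat (n ! j) ^ (s ! j)) :: rat"
  let ?M = "{m. 0 < m \<and> m < p \<and> odd (m + length s)}"
  have "(\<Sum>n\<in>T_indices (length (a # s)) p. ?f (a # s) n) =
      (\<Sum>(m, n)\<in>(SIGMA m:?M. T_indices (length s) m). ?f (a # s) (m # n))"
    unfolding list.size(4) add_Suc_right add_0_right T_indices_Suc
    by (subst sum.reindex) (auto simp: inj_on_def case_prod_unfold)
  also have "\<dots> = (\<Sum>m\<in>?M. \<Sum>n\<in>T_indices (length s) m. ?f (a # s) (m # n))"
    by (rule sum.Sigma[symmetric]) (auto simp: finite_T_indices)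
  also have "\<dots> = (\<Sum>m\<in>?M. 2 / of_nat m ^ a * (\<Sum>n\<in>T_indices (length s) m. ?f s n))"
    by (intro sum.cong refl)
      (simp add: sum_distrib_left prod.lessThan_Suc_shift del: prod.lessThan_Suc)
  also have "\<dots> = (\<Sum>m\<in>?M. T_coeff (a # s) m)"
  proof (intro sum.cong refl)
    fix m assume m: "m \<in> ?M"
    have "(if s = [] then 1 else T_trunc s m) = (\<Sum>i<m. T_coeff s i)"
      using m by (auto simp: T_trunc_def)
    then show "2 / of_nat m ^ a * (\<Sum>n\<in>T_indices (length s) m. ?f s n) = T_coeff (a # s) m"
      using m by (simp add: Cons.IH)
  qed
  also have "\<dots> = T_trunc (a # s) p"
    unfolding T_trunc_def by (rule sum.mono_neutral_left) auto
  finally show ?case by simp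
qed

lemma T_A_eq_class_trunc: "s \<noteq> [] \<Longrightarrow> T_A s = class_A (T_trunc s)"
  unfolding T_A_def sum_T_indices by simp

lemma p_integral_T_coeff:
  assumes p: "prime p" and "n < p" shows "p_integral p (T_coeff s n)"
  using assms(2)
proof (induction s arbitrary: n)
  case (Cons a s)
  have "p_integral p (2 * (1 / of_nat n) ^ a * (\<Sum>m<n. T_coeff s m))" if "n > 0"
    using Cons that by (intro p_integral_mult p_integral_sum p_integral_power p_integral_inverse_nat p p_integral_numeral Cons.IH) auto
  then show ?case using p by (auto simp: power_one_over)
qed (use p in auto)

lemma p_integral_T_trunc: "prime p \<Longrightarrow> p_integral p (T_trunc s p)"
  unfolding T_trunc_def by (intro p_integral_sum p_integral_T_coeff) auto

text \<open>
  A finite sum of even depth is, up to the factor \<open>p / 2\<close>, the \<open>p\<close>-th coefficient of a series with one more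
  leading \<open>1\<close>. Hence identities between series, read at \<open>z\<^sup>p\<close> and multiplied by \<open>p\<close>, give
  congruences between finite sums.
\<close>

lemma p_times_T_coeff_1:
  assumes "odd p" "even (length s)"
  shows "of_nat p * T_coeff (1 # s) p = 2 * T_trunc s p"
  using assms by (cases "p = 0") (auto simp: T_trunc_def)

definition T_fps :: "nat list \<Rightarrow> rat fps" where
  "T_fps s = Abs_fps (T_coeff s)"

text \<open>
  The expansion of \<open>2 / (1 - z\<^sup>2)\<close>, the form whose integration puts a \<open>1\<close> in front of \<open>s\<close>.
\<close>

definition T_form :: "rat fps" where
  "T_form = Abs_fps (\<lambda>n. if even n then 2 else 0)"

lemma T_form_times: "T_form * (1 - fps_X ^ 2) = 2"
proof (rule fps_ext)
  fix n
  have "(T_form * (1 - fps_X ^ 2)) $ n = T_form $ n - (T_form * fps_X ^ 2) $ n"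
    by (simp add: algebra_simps)
  also have "\<dots> = (2 :: rat fps) $ n"
    by (subst fps_X_power_mult_right_nth) (auto simp: T_form_def fps_numeral_nth elim: oddE)
  finally show "(T_form * (1 - fps_X ^ 2)) $ n = (2 :: rat fps) $ n" .
qed

lemma T_fps_Nil [simp]: "T_fps [] = 1"
  by (rule fps_ext) (simp add: T_fps_def)

lemma T_fps_Cons_nth_0 [simp]: "T_fps (a # s) $ 0 = 0"
  by (simp add: T_fps_def)

lemma deriv_T_fps_1: "fps_deriv (T_fps (Suc 0 # s)) = T_form * T_fps s"
proof (rule fps_ext)
  fix n
  have "(T_form * T_fps s) $ n = (\<Sum>i=0..n. T_coeff s i * (if even (n - i) then 2 else 0))"
    by (subst mult.commute) (simp add: fps_mult_nth T_fps_def T_form_def)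
  also have "\<dots> = (\<Sum>i=0..n. if even (n + length s) then 2 * T_coeff s i else 0)"
    by (intro sum.cong refl) (auto simp: T_coeff_parity)
  also have "\<dots> = fps_deriv (T_fps (Suc 0 # s)) $ n"
    by (simp add: T_fps_def sum_distrib_left atLeast0AtMost lessThan_Suc_atMost)
  finally show "fps_deriv (T_fps (Suc 0 # s)) $ n = (T_form * T_fps s) $ n" ..
qed

lemma deriv_T_fps_Suc: "fps_X * fps_deriv (T_fps (Suc a # s)) = T_fps (a # s)"
proof (rule fps_ext)
  fix n
  show "(fps_X * fps_deriv (T_fps (Suc a # s))) $ n = T_fps (a # s) $ n"
    by (cases n) (simp_all add: T_fps_def del: of_nat_Suc)
qed

text \<open>
  The logarithm of \<open>(1 + z) / (1 - z)\<close>.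
\<close>

definition T_log :: "rat fps" where "T_log = T_fps [1]"

lemma T_log_nth_0 [simp]: "T_log $ 0 = 0" by (simp add: T_log_def)

lemma deriv_T_log: "fps_deriv T_log = T_form"
  by (simp add: T_log_def deriv_T_fps_1)

lemma T_fps_replicate_1: "fps_const (fact d) * T_fps (replicate d 1) = T_log ^ d"
proof (induction d)
  case (Suc d)
  have "fps_deriv (fps_const (fact (Suc d)) * T_fps (Suc 0 # replicate d 1)) =
      of_nat (Suc d) * T_form * (fps_const (fact d) * T_fps (replicate d 1))"
    by (simp add: deriv_T_fps_1 mult_ac flip: fps_of_nat fps_const_mult)
  also have "\<dots> = fps_deriv (T_log ^ Suc d)"
    unfolding Suc by (simp add: fps_deriv_power' deriv_T_log del: power_Suc of_nat_Suc)
  finally show ?case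
    by (subst (asm) fps_deriv_eq_iff) simp
qed simp

section \<open>Shuffle products with the logarithm\<close>

definition ones_two_ones :: "nat \<Rightarrow> nat \<Rightarrow> nat list" where
  "ones_two_ones b c = replicate b 1 @ 2 # replicate c 1"

lemma ones_two_ones_0: "ones_two_ones 0 c = Suc 1 # replicate c 1"
  by (simp add: ones_two_ones_def numeral_2_eq_2)

lemma ones_two_ones_Suc: "ones_two_ones (Suc b) c = Suc 0 # ones_two_ones b c"
  by (simp add: ones_two_ones_def)

lemma length_ones_two_ones [simp]: "length (ones_two_ones b c) = b + c + 1"
  by (simp add: ones_two_ones_def)

lemma ones_two_ones_not_Nil [simp]: "ones_two_ones b c \<noteq> []"
  by (simp add: ones_two_ones_def)

lemma T_fps_nth_0: "s \<noteq> [] \<Longrightarrow> T_fps s $ 0 = 0"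
  by (cases s) auto

lemma T_log_times_T_fps_ones:
  "T_log * T_fps (replicate d 1) = of_nat (Suc d) * T_fps (replicate (Suc d) 1)"
proof -
  have "fps_const (fact d) * (T_log * T_fps (replicate d 1)) = T_log ^ Suc d"
    using T_fps_replicate_1[of d] by (simp add: mult_ac)
  also have "\<dots> = fps_const (fact d) * (of_nat (Suc d) * T_fps (replicate (Suc d) 1))"
    unfolding T_fps_replicate_1[symmetric] by (simp add: mult_ac flip: fps_of_nat fps_const_mult del: replicate.simps)
  finally show ?thesis by simp
qed

text \<open>
  The shuffle product of the one-letter word with the word of \<open>({1}\<^sup>b, 2, {1}\<^sup>c)\<close>, which has
  \<open>b\<close> letters \<open>2 dz / (1 - z\<^sup>2)\<close>, then one \<open>dz / z\<close>, then \<open>c + 1\<close> letters \<open>2 dz / (1 - z\<^sup>2)\<close>: there are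
  \<open>b + 1\<close> places for the new letter before \<open>dz / z\<close> and \<open>c + 2\<close> places after it. Both sides have
  no constant term, so it suffices to compare derivatives, by induction on the length of the
  first block.
\<close>

lemma T_log_times_T_fps:
  "T_log * T_fps (ones_two_ones b c) =
     of_nat (b + 1) * T_fps (ones_two_ones (Suc b) c) + of_nat (c + 2) * T_fps (ones_two_ones b (Suc c))"
proof (induction b)
  case 0
  have "fps_X * fps_deriv (T_log * T_fps (ones_two_ones 0 c)) =
      fps_X * T_form * T_fps (ones_two_ones 0 c) + T_log * (fps_X * fps_deriv (T_fps (Suc 1 # replicate c 1)))"
    by (simp add: deriv_T_log ones_two_ones_0 algebra_simps)
  also have "T_log * (fps_X * fps_deriv (T_fps (Suc 1 # replicate c 1))) =
      of_nat (c + 2) * T_fps (1 # replicate (Suc c) 1)"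
    unfolding deriv_T_fps_Suc using T_log_times_T_fps_ones[of "Suc c"] by simp
  also have "\<dots> = of_nat (c + 2) * (fps_X * fps_deriv (T_fps (ones_two_ones 0 (Suc c))))"
    unfolding ones_two_ones_0 deriv_T_fps_Suc ..
  finally have "fps_X * fps_deriv (T_log * T_fps (ones_two_ones 0 c)) =
      fps_X * fps_deriv (T_fps (ones_two_ones (Suc 0) c) + of_nat (c + 2) * T_fps (ones_two_ones 0 (Suc c)))"
    by (simp add: ones_two_ones_Suc deriv_T_fps_1 algebra_simps flip: fps_of_nat)
  then have "fps_deriv (T_log * T_fps (ones_two_ones 0 c)) =
      fps_deriv (T_fps (ones_two_ones (Suc 0) c) + of_nat (c + 2) * T_fps (ones_two_ones 0 (Suc c)))"
    by (metis fps_X_neq_zero mult_left_cancel)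
  then show ?case
    by (subst (asm) fps_deriv_eq_iff) (simp add: T_fps_nth_0)
next
  case (Suc b)
  have "fps_deriv (T_log * T_fps (ones_two_ones (Suc b) c)) =
      T_form * (T_fps (ones_two_ones (Suc b) c) + T_log * T_fps (ones_two_ones b c))"
    by (simp add: deriv_T_log ones_two_ones_Suc deriv_T_fps_1 algebra_simps)
  also have "\<dots> = T_form * (of_nat (Suc b + 1) * T_fps (ones_two_ones (Suc b) c)
      + of_nat (c + 2) * T_fps (ones_two_ones b (Suc c)))"
    unfolding Suc by (simp add: algebra_simps)
  also have "\<dots> = fps_deriv (of_nat (Suc b + 1) * T_fps (ones_two_ones (Suc (Suc b)) c)
      + of_nat (c + 2) * T_fps (ones_two_ones (Suc b) (Suc c)))"
    by (simp add: ones_two_ones_Suc deriv_T_fps_1 algebra_simps flip: fps_of_nat)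
  finally show ?case
    by (subst (asm) fps_deriv_eq_iff) (simp add: T_fps_nth_0)
qed

text \<open>
  Although the individual \<open>p\<close>-th coefficients have \<open>p\<close> in the denominator, that of a product of
  two series without constant term involves only coefficients of smaller order.
\<close>

lemma p_integral_T_log_times_T_fps:
  assumes "prime p" "s \<noteq> []" shows "p_integral p ((T_log * T_fps s) $ p)"
  unfolding fps_mult_nth
proof (intro p_integral_sum)
  fix i assume i: "i \<in> {0..p}"
  consider "i = 0" | "i = p" | "0 < i" "i < p" using i by fastforce
  then show "p_integral p (T_log $ i * T_fps s $ (p - i))"
  proof cases
    case 3
    then show ?thesis
      using assms by (auto simp: T_log_def T_fps_def intro!: p_integral_mult p_integral_T_coeff simp del: T_coeff.simps)
  qed (use assms in \<open>auto simp: T_fps_nth_0\<close>)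
qed

lemma of_nat_times_fps_nth: "(of_nat n * f) $ k = of_nat n * (f $ k :: rat)"
  by (simp flip: fps_of_nat)

text \<open>
  The shuffle product at \<open>z\<^sup>p\<close>. Both terms on its right hand side begin with a \<open>1\<close>, and
  \<open>p\<close> times the left hand side vanishes modulo \<open>p\<close>.
\<close>

lemma T_trunc_move_two:
  assumes p: "prime p" "odd p" and "even (b + c)"
  shows "p_cong p (of_nat (b + 2) * T_trunc (ones_two_ones (Suc b) c) p)
     (- (of_nat (c + 2) * T_trunc (ones_two_ones b (Suc c)) p))"
proof -
  let ?A = "ones_two_ones (Suc b) c" and ?B = "ones_two_ones b (Suc c)"
  have "of_nat p * (T_log * T_fps ?A) $ p = of_nat (b + 2) * (of_nat p * T_coeff (1 # ?A) p)
      + of_nat (c + 2) * (of_nat p * T_coeff (1 # ?B) p)"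
    unfolding T_log_times_T_fps by (simp add: of_nat_times_fps_nth ones_two_ones_Suc T_fps_def algebra_simps del: of_nat_Suc of_nat_add T_coeff.simps)
  also have "\<dots> = 2 * (of_nat (b + 2) * T_trunc ?A p + of_nat (c + 2) * T_trunc ?B p)"
    using assms by (subst (1 2) p_times_T_coeff_1) (simp_all add: algebra_simps)
  finally have "p_cong p (of_nat 2 * (of_nat (b + 2) * T_trunc ?A p + of_nat (c + 2) * T_trunc ?B p)) (of_nat 2 * 0)"
    using p_cong_p_mult[OF p_integral_T_log_times_T_fps[OF p(1), of ?A]] by simp
  then have "p_cong p (of_nat (b + 2) * T_trunc ?A p + of_nat (c + 2) * T_trunc ?B p) 0"
    using p by (elim p_cong_mult_nat_cancel[rotated]) (auto intro: prime_gt_1_nat order.not_eq_order_implies_strict dest: prime_ge_2_nat)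
  then have "p_cong p (of_nat (b + 2) * T_trunc ?A p + of_nat (c + 2) * T_trunc ?B p - of_nat (c + 2) * T_trunc ?B p) (0 - of_nat (c + 2) * T_trunc ?B p)"
    using p by (intro p_cong_diff p_cong_refl p_integral_mult p_integral_nat p_integral_T_trunc) 
  then show ?thesis by simp
qed

lemma p_integral_T_coeff_ones:
  assumes "prime p" "2 \<le> j" "j < p"
  shows "p_integral p (T_coeff (replicate j 1) p)"
proof -
  obtain d where d: "j = Suc d" "d > 0" using assms by (cases j) auto
  have "p_integral p ((T_log * T_fps (replicate d 1)) $ p)"
    using assms d by (intro p_integral_T_log_times_T_fps) auto
  then have "p_integral p (of_nat j * T_coeff (replicate j 1) p)"
    unfolding T_log_times_T_fps_ones d of_nat_times_fps_nth by (simp add: T_fps_def del: of_nat_Suc T_coeff.simps)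
  then have "p_integral p (of_nat j * T_coeff (replicate j 1) p / of_nat j)"
    using assms by (intro p_integral_div_nat) auto
  then show ?thesis using assms by simp
qed

text \<open>
  The same argument for an empty first block. Now the second term of the shuffle product begins
  with a \<open>2\<close>, so its \<open>p\<close>-th coefficient is, up to \<open>p\<close>, that of a divided power of the logarithm
  instead of a finite sum.
\<close>

lemma T_trunc_two_ones:
  assumes p: "prime p" "odd p" and "odd c" "c + 2 < p"
  shows "p_cong p (2 * T_trunc (ones_two_ones 0 c) p) (- (of_nat (c + 2) * T_coeff (replicate (c + 2) 1) p))"
proof -
  let ?A = "ones_two_ones 0 c" and ?g = "of_nat (c + 2) * T_coeff (replicate (c + 2) 1) p"
  have p0: "p > 0" using p by (simp add: prime_gt_0_nat)
  have "of_nat p * T_coeff (ones_two_ones 0 (Suc c)) p = T_coeff (replicate (c + 2) 1) p"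
    using p0 by (simp add: ones_two_ones_0)
  moreover have "of_nat p * (T_log * T_fps ?A) $ p = of_nat p * T_coeff (1 # ?A) p
      + of_nat (c + 2) * (of_nat p * T_coeff (ones_two_ones 0 (Suc c)) p)"
    unfolding T_log_times_T_fps by (simp add: of_nat_times_fps_nth ones_two_ones_Suc T_fps_def algebra_simps del: of_nat_Suc of_nat_add T_coeff.simps)
  ultimately have "of_nat p * (T_log * T_fps ?A) $ p = 2 * T_trunc ?A p + ?g"
    using assms p_times_T_coeff_1[of p ?A] by simp
  then have "p_cong p (2 * T_trunc ?A p + ?g) 0"
    using p_cong_p_mult[OF p_integral_T_log_times_T_fps[OF p(1), of ?A]] by simp
  then have "p_cong p (2 * T_trunc ?A p + ?g - ?g) (0 - ?g)"
    using assms by (intro p_cong_diff p_cong_refl p_integral_mult p_integral_nat p_integral_T_coeff_ones) auto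
  then show ?thesis by simp
qed

text \<open>
  With \<open>Q = exp(T_log) (1 - z)\<close> the differential equation for the logarithm becomes
  \<open>(1 + z) Q' = Q\<close>, whose solution with constant term \<open>1\<close> is \<open>1 + z\<close>.
\<close>

lemma exp_T_log: "(fps_exp 1 oo T_log) * (1 - fps_X) = 1 + fps_X"
proof -
  let ?E = "fps_exp 1 oo T_log :: rat fps"
  have E': "fps_deriv ?E = ?E * T_form"
    by (simp add: fps_compose_deriv deriv_T_log)
  define Q where "Q = ?E * (1 - fps_X)"
  have "(1 - fps_X) * ((1 + fps_X) * fps_deriv Q) = (?E * (T_form * (1 - fps_X ^ 2)) - ?E * (1 + fps_X)) * (1 - fps_X)"
    by (simp add: Q_def E' algebra_simps power2_eq_square)
  also have "\<dots> = (1 - fps_X) * Q"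
    unfolding T_form_times by (simp add: Q_def algebra_simps)
  finally have Q': "(1 + fps_X) * fps_deriv Q = Q"
    by (metis fps_X_neq_one mult_left_cancel right_minus_eq)
  have "Q $ n = (1 + fps_X :: rat fps) $ n" for n
  proof (induction n)
    case 0
    show ?case by (simp add: Q_def)
  next
    case (Suc n)
    have rec: "of_nat (Suc n) * Q $ Suc n + of_nat n * Q $ n = Q $ n"
    proof -
      have "Q $ n = ((1 + fps_X) * fps_deriv Q) $ n" by (simp only: Q')
      then show ?thesis by (cases n) (simp_all add: distrib_right)
    qed
    show ?case
    proof (cases "n \<le> 1")
      case True
      then show ?thesis using rec Suc by (cases n) auto
    next
      case False
      then show ?thesis using rec Suc by (auto simp: fps_X_def)
    qed
  qed
  then show ?thesis unfolding Q_def by (rule fps_ext)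
qed

section \<open>Powers of the logarithm and Bernoulli numbers\<close>

definition two_sinh :: "rat fps" where "two_sinh = fps_exp 1 - fps_exp (-1)"

lemma two_sinh_nth: "two_sinh $ n = (1 - (-1) ^ n) / fact n"
  by (simp add: two_sinh_def diff_divide_distrib)

text \<open>
  As \<open>exp(T_log) = (1 + z) / (1 - z)\<close>, the difference of this fraction and its inverse is
  \<open>4 z / (1 - z\<^sup>2)\<close>.
\<close>

lemma two_sinh_T_log: "two_sinh oo T_log = 2 * fps_X * T_form"
proof -
  let ?E = "fps_exp 1 oo T_log :: rat fps" and ?E' = "fps_exp (-1) oo T_log :: rat fps"
  have "?E * ?E' = (fps_exp 1 * fps_exp (-1)) oo T_log"
    by (simp add: fps_compose_mult_distrib)
  also have "fps_exp 1 * fps_exp (-1 :: rat) = 1"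
    by (simp flip: fps_exp_add_mult)
  finally have EE: "?E * ?E' = 1" by simp
  have "(1 + fps_X) * ?E' = (1 - fps_X) * (?E * ?E')"
    unfolding exp_T_log[symmetric] by (simp add: mult_ac)
  then have E': "(1 + fps_X) * ?E' = 1 - fps_X" by (simp add: EE)
  have "(two_sinh oo T_log) * (1 - fps_X ^ 2) = (1 + fps_X) * (?E * (1 - fps_X)) - ((1 + fps_X) * ?E') * (1 - fps_X)"
    by (simp add: two_sinh_def fps_compose_sub_distrib algebra_simps power2_eq_square)
  also have "\<dots> = 2 * fps_X * 2"
    unfolding E' exp_T_log by (simp add: algebra_simps)
  also have "\<dots> = 2 * fps_X * T_form * (1 - fps_X ^ 2)"
    unfolding T_form_times[symmetric] by (simp add: mult_ac)
  finally show ?thesis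
    using T_form_times by (metis mult_cancel_right mult_zero_right zero_neq_numeral)
qed

lemma T_log_power_nth: "T_log ^ j $ n = fact j * T_coeff (replicate j 1) n"
  unfolding T_fps_replicate_1[symmetric] by (simp add: T_fps_def)

text \<open>
  Multiply the preceding identity by a power of the logarithm: on the right this produces a
  derivative of the next power, on the left a combination of all higher powers. At \<open>n = p\<close> the
  factor \<open>n\<close> on the right makes this a homogeneous linear recurrence modulo \<open>p\<close>, as long as the
  coefficient next to it is \<open>p\<close>-integral.
\<close>

lemma T_coeff_ones_shift:
  "(\<Sum>j=i..n. two_sinh $ (j - i) * (fact j * T_coeff (replicate j 1) n)) =
     2 * of_nat n * fact i * T_coeff (replicate (Suc i) 1) n"
proof -
  have "(\<Sum>j=i..n. two_sinh $ (j - i) * (fact j * T_coeff (replicate j 1) n)) =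
      (\<Sum>j=0..n. (fps_X ^ i * two_sinh) $ j * T_log ^ j $ n)"
    by (rule sum.mono_neutral_cong_left) (auto simp: T_log_power_nth fps_X_power_mult_nth)
  also have "\<dots> = ((fps_X ^ i * two_sinh) oo T_log) $ n"
    by (simp add: fps_compose_nth)
  also have "(fps_X ^ i * two_sinh) oo T_log = T_log ^ i * (2 * fps_X * T_form)"
    by (simp add: fps_compose_mult_distrib two_sinh_T_log flip: fps_compose_power)
  finally have *: "(\<Sum>j=i..n. two_sinh $ (j - i) * (fact j * T_coeff (replicate j 1) n)) =
      (T_log ^ i * (2 * fps_X * T_form)) $ n" .
  have "of_nat (Suc i) * (T_log ^ i * (2 * fps_X * T_form)) = 2 * (fps_X * fps_deriv (T_log ^ Suc i))"
    by (simp add: fps_deriv_power' deriv_T_log mult_ac del: power_Suc of_nat_Suc)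
  then have "of_nat (Suc i) * (T_log ^ i * (2 * fps_X * T_form)) $ n = 2 * (fps_X * fps_deriv (T_log ^ Suc i)) $ n"
    by (metis of_nat_times_fps_nth of_nat_numeral)
  also have "(fps_X * fps_deriv (T_log ^ Suc i)) $ n = of_nat n * (T_log ^ Suc i) $ n"
    by (cases n) (simp_all del: of_nat_Suc power_Suc)
  also have "\<dots> = of_nat (Suc i) * (of_nat n * fact i * T_coeff (replicate (Suc i) 1) n)"
    unfolding T_log_power_nth by (simp del: T_coeff.simps replicate.simps)
  finally have "(T_log ^ i * (2 * fps_X * T_form)) $ n = 2 * of_nat n * fact i * T_coeff (replicate (Suc i) 1) n"
    by (simp add: algebra_simps del: of_nat_Suc T_coeff.simps replicate.simps)
  with * show ?thesis by simp
qed

definition bernoulli_fps :: "rat fps" where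
  "bernoulli_fps = Abs_fps (\<lambda>n. bernoulli_number n / fact n)"

text \<open>
  The series \<open>2 x / (e\<^sup>2\<^sup>x - 1)\<close>, that is, \<open>bernoulli_fps\<close> at \<open>2 x\<close>.
\<close>

definition bernoulli_fps2 :: "rat fps" where
  "bernoulli_fps2 = Abs_fps (\<lambda>n. 2 ^ n * (bernoulli_number n / fact n))"

text \<open>
  By partial fractions, \<open>2 x / (e\<^sup>x - 1) - 2 x / (e\<^sup>2\<^sup>x - 1) = 2 x e\<^sup>x / (e\<^sup>2\<^sup>x - 1)\<close>, which is
  \<open>x / sinh x\<close>.
\<close>

definition x_over_sinh :: "rat fps" where
  "x_over_sinh = 2 * bernoulli_fps - bernoulli_fps2"

lemma bernoulli_fps2_eq: "(fps_exp 2 - 1) * bernoulli_fps2 = 2 * fps_X"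
proof -
  have "bernoulli_fps2 = bernoulli_fps oo (fps_const 2 * fps_X)"
    by (simp add: bernoulli_fps2_def fps_compose_linear bernoulli_fps_def)
  moreover have "((fps_exp 1 - 1) * bernoulli_fps) oo (fps_const 2 * fps_X) = (fps_X :: rat fps) oo (fps_const 2 * fps_X)"
    using bernoulli_number_generating_function by (simp add: bernoulli_fps_def)
  ultimately show ?thesis
    by (simp add: fps_compose_mult_distrib fps_compose_sub_distrib numeral_fps_const)
qed

lemma x_over_sinh_times_exp: "x_over_sinh * fps_exp (-1) = bernoulli_fps2"
  and x_over_sinh_times_two_sinh: "x_over_sinh * two_sinh = 2 * fps_X"
proof -
  let ?E = "fps_exp 1 :: rat fps"
  have E2: "fps_exp 2 = ?E * ?E" by (simp flip: fps_exp_add_mult)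
  have B: "(?E - 1) * bernoulli_fps = fps_X"
    using bernoulli_number_generating_function by (simp add: bernoulli_fps_def)
  have "(fps_exp 2 - 1) * x_over_sinh = 2 * ((?E + 1) * ((?E - 1) * bernoulli_fps)) - (fps_exp 2 - 1) * bernoulli_fps2"
    by (simp add: x_over_sinh_def E2 algebra_simps)
  also have "\<dots> = ?E * ((fps_exp 2 - 1) * bernoulli_fps2)"
    unfolding B bernoulli_fps2_eq by (simp add: algebra_simps)
  finally have "(fps_exp 2 - 1) * x_over_sinh = (fps_exp 2 - 1) * (?E * bernoulli_fps2)"
    by (simp add: mult_ac)
  moreover have "fps_exp 2 - 1 \<noteq> (0 :: rat fps)" by simp
  ultimately have 1: "x_over_sinh = fps_exp 1 * bernoulli_fps2"
    by (metis mult_left_cancel)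
  have EE: "?E * fps_exp (-1) = 1" by (simp flip: fps_exp_add_mult)
  show 2: "x_over_sinh * fps_exp (-1) = bernoulli_fps2"
    unfolding 1 using EE by (simp add: mult_ac)
  have "x_over_sinh * two_sinh = (fps_exp 2 - 1) * bernoulli_fps2"
    unfolding two_sinh_def right_diff_distrib 2 by (simp add: 1 E2 algebra_simps)
  then show "x_over_sinh * two_sinh = 2 * fps_X" by (simp add: bernoulli_fps2_eq)
qed

lemma x_over_sinh_nth: "x_over_sinh $ n = (2 - 2 ^ n) * bernoulli_number n / fact n"
proof -
  have "(2 * bernoulli_fps) $ n = 2 * (bernoulli_fps $ n)"
    using of_nat_times_fps_nth[of 2] by simp
  then show ?thesis
    by (simp add: x_over_sinh_def bernoulli_fps_def bernoulli_fps2_def field_simps)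
qed

lemma two_sinh_nth_0_1 [simp]: "two_sinh $ 0 = 0" "two_sinh $ Suc 0 = 2"
  by (simp_all add: two_sinh_nth)

lemma p_integral_two_sinh: "prime p \<Longrightarrow> n < p \<Longrightarrow> p_integral p (two_sinh $ n)"
  unfolding two_sinh_nth
  using p_integral_mult[OF _ p_integral_inverse_fact, of p "1 - (-1) ^ n" n]
  by (simp add: p_integral_intros)

lemma p_integral_bernoulli_fps:
  assumes p: "prime p" shows "n + 1 < p \<Longrightarrow> p_integral p (bernoulli_fps $ n)"
proof (induction n rule: less_induct)
  case (less n)
  let ?F = "fps_exp 1 - 1 :: rat fps"
  have F: "p_integral p (?F $ i)" if "i < p" for i
    using p_integral_inverse_fact[OF p that] by (cases i) (auto simp: fps_one_nth simp del: fact_Suc)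
  have "(\<Sum>i=0..Suc n. bernoulli_fps $ i * ?F $ (Suc n - i)) = fps_X $ Suc n"
    using bernoulli_number_generating_function unfolding fps_mult_nth[symmetric]
    by (simp add: bernoulli_fps_def mult.commute)
  then have "bernoulli_fps $ n = fps_X $ Suc n - (\<Sum>i<n. bernoulli_fps $ i * ?F $ (Suc n - i))"
    by (simp add: atLeast0AtMost flip: lessThan_Suc_atMost)
  also have "p_integral p \<dots>"
    using less by (intro p_integral_intros less.IH F) (auto simp: fps_X_def)
  finally show ?case .
qed

lemma p_integral_bernoulli_number:
  assumes p: "prime p" and "n + 1 < p" shows "p_integral p (bernoulli_number n)"
proof -
  have "bernoulli_number n = fact n * (bernoulli_fps $ n)" by (simp add: bernoulli_fps_def)
  also have "p_integral p \<dots>"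
    using assms by (intro p_integral_mult p_integral_fact p_integral_bernoulli_fps)
  finally show ?thesis .
qed

lemma p_integral_x_over_sinh:
  assumes p: "prime p" and "n + 1 < p" shows "p_integral p (x_over_sinh $ n)"
proof -
  have "p_integral p ((2 - 2 ^ n) * bernoulli_number n * (1 / fact n))"
    using assms by (intro p_integral_intros p_integral_bernoulli_number p_integral_inverse_fact) auto
  then show ?thesis by (simp add: x_over_sinh_nth)
qed

text \<open>
  Descending from the power \<open>p\<close>, the \<open>p\<close>-th coefficients of the powers of the logarithm satisfy
  modulo \<open>p\<close> the recurrence that expresses \<open>(x / sinh x) \<cdot> 2 sinh x = 2 x\<close>, and the initial value
  \<open>2\<^sup>p\<close> is congruent to \<open>2\<close>.
\<close>

lemma T_log_power_p_cong:
  assumes p: "prime p" "odd p"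
  shows "n + 2 < p \<Longrightarrow> p_cong p ((T_log ^ (p - n)) $ p) (2 * x_over_sinh $ n)"
proof (induction n rule: less_induct)
  case (less n)
  define c where "c = (\<lambda>j. (T_log ^ (p - j)) $ p)"
  have C: "(\<Sum>j<Suc n. two_sinh $ (Suc n - j) * x_over_sinh $ j) = (2 * fps_X) $ Suc n"
  proof -
    have "(x_over_sinh * two_sinh) $ Suc n = (\<Sum>j<Suc n. two_sinh $ (Suc n - j) * x_over_sinh $ j)"
      unfolding fps_mult_nth by (simp add: atLeast0AtMost mult.commute flip: lessThan_Suc_atMost)
    then show ?thesis by (simp add: x_over_sinh_times_two_sinh)
  qed
  have "(\<Sum>j=p - Suc n..p. two_sinh $ (j - (p - Suc n)) * (T_log ^ j) $ p) =
      (\<Sum>j\<le>Suc n. two_sinh $ (Suc n - j) * c j)"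
    using less.prems
    by (intro sum.reindex_bij_witness[of _ "\<lambda>j. p - j" "\<lambda>j. p - j"]) (auto simp: c_def add.commute)
  then have c: "(\<Sum>j<Suc n. two_sinh $ (Suc n - j) * c j) =
      2 * of_nat p * fact (p - Suc n) * T_coeff (replicate (p - n) 1) p"
    using T_coeff_ones_shift[of "p - Suc n" p] less.prems
    by (simp add: T_log_power_nth Suc_diff_Suc flip: lessThan_Suc_atMost del: T_coeff.simps)
  show ?case
  proof (cases "n = 0")
    case True
    have "(T_log ^ p) $ p = 2 ^ p"
      by (simp add: startsby_zero_power_nth_same T_log_def T_fps_def)
    also have "\<dots> = 2 * 2 ^ (p - 1)"
      using p by (metis power_eq_if prime_gt_0_nat less_irrefl)
    also have "p_cong p \<dots> (2 * 1)"
      using p_cong_fermat[OF p(1), of 2] less.prems True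
      by (intro p_cong_mult_left) auto
    also have "x_over_sinh $ 0 = 1" using C True by (simp add: fps_X_def numeral_fps_const)
    then have "(2 * 1 :: rat) = 2 * x_over_sinh $ n" using True by simp
    finally show ?thesis using True by simp
  next
    case False
    then have C0: "2 * x_over_sinh $ n = 0 - (\<Sum>j<n. two_sinh $ (Suc n - j) * x_over_sinh $ j)"
      using C by (simp add: fps_X_def numeral_fps_const algebra_simps)
    have "p_cong p (2 * of_nat p * fact (p - Suc n) * T_coeff (replicate (p - n) 1) p) 0"
    proof -
      have "p_cong p (of_nat p * (2 * fact (p - Suc n) * T_coeff (replicate (p - n) 1) p)) 0"
        using less.prems False p
        by (intro p_cong_p_mult p_integral_mult p_integral_fact p_integral_numeral p_integral_T_coeff_ones) auto
      then show ?thesis by (simp add: mult_ac del: T_coeff.simps)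
    qed
    then have "p_cong p ((\<Sum>j<Suc n. two_sinh $ (Suc n - j) * c j) - (\<Sum>j<n. two_sinh $ (Suc n - j) * c j))
       (0 - (\<Sum>j<n. two_sinh $ (Suc n - j) * (2 * x_over_sinh $ j)))"
      unfolding c using less.prems p
      by (intro p_cong_diff p_cong_sum p_cong_mult_left p_integral_two_sinh)
         (auto simp: c_def intro: less.IH)
    then have "p_cong p (2 * c n) (2 * (0 - (\<Sum>j<n. two_sinh $ (Suc n - j) * x_over_sinh $ j)))"
      by (simp add: sum_distrib_left algebra_simps)
    then have "p_cong p (of_nat 2 * c n) (of_nat 2 * (2 * x_over_sinh $ n))"
      unfolding C0 by simp
    then show ?thesis
      unfolding c_def by (rule p_cong_mult_nat_cancel[OF p(1)]) (use less.prems in auto)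
  qed
qed

text \<open>
  The Bernoulli index \<open>N = p - (k + 2)\<close> is complementary to \<open>k + 1\<close>: these numbers add up to \<open>p - 1\<close>.
  Hence \<open>N! (k + 1)!\<close> is \<open>-1\<close> modulo \<open>p\<close> for odd \<open>k\<close>, by Wilson's theorem, and \<open>2\<^sup>N\<close> is the inverse of
  \<open>2\<^sup>k\<^sup>+\<^sup>1\<close>, by Fermat's.
\<close>

lemma T_trunc_two_ones_bernoulli:
  assumes p: "prime p" "odd p" and k: "odd k" "k + 2 < p"
  shows "p_cong p (T_trunc (ones_two_ones 0 k) p)
     ((2 - 1 / 2 ^ (k + 1)) * bernoulli_number (p - (k + 2)))"
proof -
  define N where "N = p - (k + 2)"
  let ?B = "bernoulli_number N"
  have N: "N + 2 < p" "p - N = k + 2" using k p odd_pos[OF k(1)] by (auto simp: N_def)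
  have Bint: "p_integral p ?B" using N p by (intro p_integral_bernoulli_number) auto
  have kp: "k + 1 < p" using k by simp
  have inv: "p_integral p (1 / fact (k + 1))" "p_integral p (1 / fact N)"
    using p k N by (auto intro!: p_integral_inverse_fact simp del: fact_Suc)
  have "p_cong p (2 * T_trunc (ones_two_ones 0 k) p) (- (of_nat (k + 2) * T_coeff (replicate (k + 2) 1) p))"
    using p k by (rule T_trunc_two_ones)
  also have "\<dots> = - ((1 / fact (k + 1)) * (T_log ^ (p - N)) $ p)"
  proof -
    have "k + 2 = Suc (k + 1)" by simp
    then have "(fact (k + 2) :: rat) = of_nat (k + 2) * fact (k + 1)" by (simp only: fact_Suc)
    then show ?thesis unfolding N(2) T_log_power_nth
      by (simp del: fact_Suc of_nat_Suc of_nat_add T_coeff.simps replicate.simps)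
  qed
  also have "p_cong p \<dots> (- ((1 / fact (k + 1)) * (2 * x_over_sinh $ N)))"
    using p N inv by (intro p_cong_minus p_cong_mult_left T_log_power_p_cong) 
  also have "\<dots> = of_nat 2 * ((- 1) * ((2 - 2 ^ N) * ?B * (1 / fact N) * (1 / fact (k + 1))))"
    by (simp add: x_over_sinh_nth)
  finally have "p_cong p (T_trunc (ones_two_ones 0 k) p) ((- 1) * ((2 - 2 ^ N) * ?B * (1 / fact N) * (1 / fact (k + 1))))"
    using p_cong_mult_nat_cancel[OF p(1), of 2] k by simp
  also have "p_cong p \<dots> ((fact N * fact (k + 1)) * ((2 - 2 ^ N) * ?B * (1 / fact N) * (1 / fact (k + 1))))"
  proof (rule p_cong_mult[OF p_cong_sym p_cong_refl])
    have "p - 1 - (k + 1) = N" by (simp add: N_def)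
    then show "p_cong p (fact N * fact (k + 1)) (- 1)"
      using fact_reflect[OF p(1) kp] k by simp
  qed (intro p_integral_intros Bint inv)
  also have "\<dots> = (2 - 2 ^ N) * ?B" by simp
  also have "p_cong p \<dots> ((2 - 1 / 2 ^ (k + 1)) * ?B)"
  proof (intro p_cong_mult p_cong_diff p_cong_refl Bint p_integral_numeral)
    have "p - 1 - (k + 1) = N" by (simp add: N_def)
    then show "p_cong p (2 ^ N) (1 / 2 ^ (k + 1))"
      using p_cong_inverse_power[OF p(1), of 2 "k + 1"] k by simp
  qed
  finally show ?thesis by (simp add: N_def)
qed

section \<open>The depth one sum\<close>

lemma odd_exp_sum_times_two_sinh:
  "(\<Sum>i<h. fps_exp (of_nat (2 * i + 1))) * two_sinh = fps_exp (of_nat (2 * h)) - (1 :: rat fps)"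
proof -
  have "(\<Sum>i<h. fps_exp (of_nat (2 * i + 1))) * two_sinh =
      (\<Sum>i<h. fps_exp (of_nat (2 * Suc i)) - fps_exp (of_nat (2 * i) :: rat))"
    unfolding two_sinh_def sum_distrib_right
    by (intro sum.cong refl) (simp add: right_diff_distrib algebra_simps flip: fps_exp_add_mult)
  also have "\<dots> = fps_exp (of_nat (2 * h)) - (1 :: rat fps)"
    by (subst sum_lessThan_telescope) simp
  finally show ?thesis .
qed

text \<open>
  The exponential generating function of the power sums over \<open>1, 3, \<dots>, 2 h - 1\<close> is
  \<open>(e\<^sup>2\<^sup>h\<^sup>x - 1) / (2 sinh x)\<close>.
\<close>

lemma odd_power_sum_eq:
  "2 * (\<Sum>i<h. of_nat (2 * i + 1) ^ M) =
     fact M * (\<Sum>i\<le>Suc M. x_over_sinh $ i * (fps_exp (of_nat (2 * h)) - 1) $ (Suc M - i))"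
proof -
  let ?V = "\<Sum>i<h. fps_exp (of_nat (2 * i + 1)) :: rat fps"
  have "2 * (fps_X * ?V) = x_over_sinh * (fps_exp (of_nat (2 * h)) - 1)"
    using odd_exp_sum_times_two_sinh[of h] x_over_sinh_times_two_sinh by (metis mult.assoc mult.commute)
  then have "2 * (fps_X * ?V) $ Suc M = (x_over_sinh * (fps_exp (of_nat (2 * h)) - 1)) $ Suc M"
    by (metis of_nat_times_fps_nth of_nat_numeral)
  also have "(fps_X * ?V) $ Suc M = (\<Sum>i<h. of_nat (2 * i + 1) ^ M) / fact M"
    by (simp add: fps_sum_nth sum_divide_distrib)
  finally show ?thesis
    by (simp add: fps_mult_nth atLeast0AtMost field_simps del: of_nat_mult)
qed

lemma T_trunc_single: "T_trunc [a] p = (\<Sum>n | n < p \<and> odd n. 2 / of_nat n ^ a)"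
proof -
  have "T_trunc [a] p = (\<Sum>n<p. if odd n then 2 / of_nat n ^ a else 0)"
    unfolding T_trunc_def
  proof (intro sum.cong refl)
    fix n show "T_coeff [a] n = (if odd n then 2 / of_nat n ^ a else 0)"
      by (cases "n > 0") (auto simp: sum.delta)
  qed
  also have "\<dots> = (\<Sum>n | n < p \<and> odd n. 2 / of_nat n ^ a)"
    by (subst sum.inter_filter[symmetric]) (auto simp: lessThan_def)
  finally show ?thesis .
qed

text \<open>
  Modulo \<open>p = 2 h + 1\<close> the exponential \<open>e\<^sup>2\<^sup>h\<^sup>x\<close> may be replaced by \<open>e\<^sup>-\<^sup>x\<close> in the generating function
  of odd power sums. Multiplied by \<open>2 x\<close> it then is the difference of the two series
  \<open>2 x / (e\<^sup>2\<^sup>x - 1)\<close> and \<open>x / sinh x\<close>. Both have multiples of Bernoulli numbers as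
  coefficients.
\<close>

lemma T_trunc_single_bernoulli:
  assumes p: "prime p" "odd p" and k: "odd k" "k + 2 < p"
  shows "p_cong p (T_trunc [k + 2] p) ((2 - 1 / 2 ^ k) * (bernoulli_number (p - (k + 2)) / of_nat (k + 2)))"
proof -
  define N where "N = p - (k + 2)"
  define M where "M = N - 1"
  define h where "h = p div 2"
  let ?B = "bernoulli_number N"
  have h: "p = 2 * h + 1" using p by (auto simp: h_def elim: oddE)
  have N: "N = Suc M" "N + 1 < p" using k p odd_pos[OF k(1)] by (auto simp: N_def M_def)
  have Bint: "p_integral p ?B" using N p by (intro p_integral_bernoulli_number) auto
  have "T_trunc [k + 2] p = (\<Sum>n | n < p \<and> odd n. 2 * (1 / of_nat n ^ (k + 2)))"
    unfolding T_trunc_single by simp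
  also have "p_cong p \<dots> (\<Sum>n | n < p \<and> odd n. 2 * of_nat n ^ M)"
  proof (intro p_cong_sum p_cong_mult_left p_integral_numeral)
    fix n assume "n \<in> {n. n < p \<and> odd n}"
    then have "p_cong p (of_nat n ^ (p - 1 - (k + 2))) (1 / of_nat n ^ (k + 2))"
      using k odd_pos by (intro p_cong_inverse_power[OF p(1)]) auto
    moreover have "p - 1 - (k + 2) = M" by (simp add: M_def N_def)
    ultimately show "p_cong p (1 / of_nat n ^ (k + 2)) (of_nat n ^ M)"
      by (metis p_cong_sym)
  qed
  also have "(\<Sum>n | n < p \<and> odd n. 2 * of_nat n ^ M) = 2 * (\<Sum>i<h. (of_nat (2 * i + 1) :: rat) ^ M)"
    unfolding sum_distrib_left
    by (rule sum.reindex_bij_witness[of _ "\<lambda>i. 2 * i + 1" "\<lambda>n. n div 2"]) (auto simp: h elim: oddE)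
  also have "\<dots> = fact M * (\<Sum>i\<le>N. x_over_sinh $ i * (fps_exp (of_nat (2 * h)) - 1) $ (N - i))"
    unfolding odd_power_sum_eq N ..
  also have "p_cong p \<dots> (fact M * (\<Sum>i\<le>N. x_over_sinh $ i * (fps_exp (- 1) - 1) $ (N - i)))"
  proof (intro p_cong_sum p_cong_mult_left p_integral_fact p_integral_x_over_sinh p)
    fix i assume i: "i \<in> {..N}"
    then show "i + 1 < p" using N by simp
    have "p_cong p (of_nat (p - 1)) (- of_nat 1)" 
      using p(1) by (rule p_cong_reflect) (simp add: h)
    moreover have "p - 1 = 2 * h" using h by simp
    ultimately have "p_cong p (of_nat (2 * h)) (- 1)" by (simp only: of_nat_1)
    then have "p_cong p (of_nat (2 * h) ^ (N - i) * (1 / fact (N - i)) - of_bool (N - i = 0))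
        ((- 1) ^ (N - i) * (1 / fact (N - i)) - of_bool (N - i = 0))"
      using N p by (intro p_cong_diff p_cong_mult p_cong_power p_cong_refl p_integral_inverse_fact) auto
    then show "p_cong p ((fps_exp (of_nat (2 * h)) - 1) $ (N - i)) ((fps_exp (- 1) - 1) $ (N - i))"
      by (simp add: fps_one_nth of_bool_def)
  qed
  also have "(\<Sum>i\<le>N. x_over_sinh $ i * (fps_exp (- 1) - 1) $ (N - i)) = (bernoulli_fps2 - x_over_sinh) $ N"
  proof -
    have "bernoulli_fps2 - x_over_sinh = x_over_sinh * (fps_exp (- 1) - 1)"
      unfolding x_over_sinh_times_exp[symmetric] by (simp add: algebra_simps)
    then show ?thesis by (simp only: fps_mult_nth atLeast0AtMost)
  qed
  also have "fact M * \<dots> = 2 * (2 ^ N - 1) * ?B * (1 / of_nat N)"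
    by (simp add: x_over_sinh_nth bernoulli_fps2_def N(1) field_simps del: of_nat_Suc power_Suc)
  also have "p_cong p \<dots> (2 * (1 / 2 ^ (k + 1) - 1) * ?B * (- (1 / of_nat (k + 2))))"
  proof (intro p_cong_mult p_cong_diff p_cong_refl Bint p_integral_intros)
    have "p - 1 - (k + 1) = N" by (simp add: N_def)
    then show "p_cong p (2 ^ N) (1 / 2 ^ (k + 1))"
      using p_cong_inverse_power[OF p(1), of 2 "k + 1"] k by simp
    show "p_cong p (1 / of_nat N) (- (1 / of_nat (k + 2)))"
      unfolding N_def using k p by (intro p_cong_inverse_reflect) auto
  qed
  also have "\<dots> = (2 - 1 / 2 ^ k) * (?B / of_nat (k + 2))"
  proof -
    have "2 * (1 / 2 ^ (k + 1) - 1 :: rat) = - (2 - 1 / 2 ^ k)" by (simp add: field_simps)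
    then show ?thesis
      by (simp only: mult_minus_left mult_minus_right minus_minus times_divide_eq_right mult_1_right)
  qed
  finally show ?thesis unfolding N_def .
qed

section \<open>Reversal\<close>

text \<open>
  The power series of \<open>((1 + z) / (1 - z))\<^sup>a\<close>. Its coefficients are polynomials in \<open>a\<close>, and their
  coefficients in turn are those of the powers of the logarithm.
\<close>

definition T_exp :: "nat \<Rightarrow> rat fps" where
  "T_exp a = fps_exp (of_nat a) oo T_log"

lemma T_coeff_ones_eq_0: "m < d \<Longrightarrow> T_coeff (replicate d 1) m = 0"
  using startsby_zero_power_prefix[of T_log d] T_log_power_nth[of d m] by simp

lemma T_exp_nth: "T_exp a $ m = (\<Sum>d=0..m. of_nat a ^ d * T_coeff (replicate d 1) m)"
  by (simp add: T_exp_def fps_compose_nth T_log_power_nth del: T_coeff.simps)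

lemma p_integral_T_exp: "prime p \<Longrightarrow> m < p \<Longrightarrow> p_integral p (T_exp a $ m)"
  unfolding T_exp_nth
  by (intro p_integral_sum p_integral_mult p_integral_power p_integral_nat p_integral_T_coeff)

lemma T_exp_power: "T_exp a * (1 - fps_X) ^ a = (1 + fps_X) ^ a"
proof -
  have "T_exp a = (fps_exp 1 oo T_log) ^ a"
    by (simp add: T_exp_def fps_compose_power fps_exp_power_mult)
  then show ?thesis by (simp add: exp_T_log flip: power_mult_distrib)
qed

text \<open>
  Multiplying \<open>2 sinh(T_log) = 2 z T_log'\<close> by the power \<open>a + 1\<close> of \<open>(1 + z) / (1 - z)\<close> gives
  \<open>2 z / (a + 1)\<close> times the derivative of that power.
\<close>

lemma T_exp_diff: "of_nat (Suc a) * (T_exp (a + 2) $ m - T_exp a $ m) = 2 * of_nat m * T_exp (Suc a) $ m"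
proof -
  have "T_exp (a + 2) - T_exp a = (two_sinh * fps_exp (of_nat (Suc a))) oo T_log"
    by (simp add: T_exp_def two_sinh_def left_diff_distrib algebra_simps flip: fps_exp_add_mult fps_compose_sub_distrib)
  also have "\<dots> = 2 * fps_X * T_form * T_exp (Suc a)"
    by (simp add: fps_compose_mult_distrib two_sinh_T_log T_exp_def)
  finally have "of_nat (Suc a) * (T_exp (a + 2) - T_exp a) = 2 * (fps_X * (of_nat (Suc a) * T_form * T_exp (Suc a)))"
    by (simp add: mult_ac)
  also have "of_nat (Suc a) * T_form * T_exp (Suc a) = fps_deriv (T_exp (Suc a))"
    by (simp add: T_exp_def fps_compose_deriv deriv_T_log fps_compose_mult_distrib mult_ac flip: fps_of_nat)
  finally have "of_nat (Suc a) * (T_exp (a + 2) - T_exp a) $ m = 2 * (fps_X * fps_deriv (T_exp (Suc a))) $ m"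
    by (metis of_nat_times_fps_nth of_nat_numeral)
  then show ?thesis by (cases m) simp_all
qed

lemma one_minus_X_power_nth: "((1 - fps_X) ^ n :: rat fps) $ i = (- 1) ^ i * of_nat (n choose i)"
proof (induction n arbitrary: i)
  case 0
  show ?case by (cases i) (auto simp: fps_one_nth)
next
  case (Suc n)
  have "((1 - fps_X) ^ Suc n :: rat fps) $ i = (1 - fps_X) ^ n $ i - (fps_X * (1 - fps_X) ^ n) $ i"
    by (simp add: left_diff_distrib)
  then show ?case by (cases i) (auto simp: Suc algebra_simps)
qed

lemma one_plus_X_minus_X_power_nth:
  "((1 + fps_X) ^ a * (1 - fps_X) ^ b :: rat fps) $ m = (if m = a + b then (- 1) ^ b else 0)"
  if "m \<ge> a + b"
  using that
proof (induction a arbitrary: m)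
  case 0
  then show ?case by (auto simp: one_minus_X_power_nth)
next
  case (Suc a)
  let ?F = "(1 + fps_X) ^ a * (1 - fps_X) ^ b :: rat fps"
  obtain m' where m: "m = Suc m'" using Suc.prems by (cases m) auto
  have "((1 + fps_X) ^ Suc a * (1 - fps_X) ^ b) $ m = ?F $ m + ?F $ m'"
    by (simp add: m algebra_simps)
  then show ?case using Suc.IH[of m] Suc.IH[of m'] Suc.prems m by auto
qed

text \<open>
  The sum is, up to the constant term, the coefficient of \<open>z\<^sup>p\<^sup>-\<^sup>1\<close> in
  \<open>((1 + z) / (1 - z))\<^sup>a / (1 - z)\<close>. Up to that order, multiplication by \<open>(1 - z)\<^sup>p\<close> has no effect modulo
  \<open>p\<close>, and it turns the series into the polynomial \<open>(1 + z)\<^sup>a (1 - z)\<^sup>p\<^sup>-\<^sup>1\<^sup>-\<^sup>a\<close> of degree \<open>p - 1\<close>.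
\<close>

lemma sum_T_exp:
  assumes p: "prime p" "odd p" and a: "a < p"
  shows "p_cong p (\<Sum>m=1..<p. T_exp a $ m) ((- 1) ^ a - 1)"
proof -
  define U where "U = Abs_fps (\<lambda>n. \<Sum>m\<le>n. T_exp a $ m)"
  have p0: "p > 0" using a by simp
  have U: "U * (1 - fps_X) = T_exp a"
  proof (rule fps_ext)
    fix n show "(U * (1 - fps_X)) $ n = T_exp a $ n"
      by (cases n) (simp_all add: U_def right_diff_distrib)
  qed
  have "U * (1 - fps_X) ^ p = (1 + fps_X) ^ a * (1 - fps_X) ^ (p - 1 - a)"
  proof -
    have "(1 - fps_X :: rat fps) ^ p = (1 - fps_X) * (1 - fps_X) ^ a * (1 - fps_X) ^ (p - 1 - a)"
      using a by (simp flip: power_add power_Suc)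
    then have "U * (1 - fps_X) ^ p = (U * (1 - fps_X)) * (1 - fps_X) ^ a * (1 - fps_X) ^ (p - 1 - a)"
      by (simp add: mult_ac)
    then show ?thesis unfolding U T_exp_power .
  qed
  then have "(U * (1 - fps_X) ^ p) $ (p - 1) = (- 1) ^ (p - 1 - a)"
    using a by (simp add: one_plus_X_minus_X_power_nth)
  also have "\<dots> = (- 1) ^ a"
    using p a by (auto simp: minus_one_power_iff even_diff_nat)
  finally have top: "(\<Sum>i=0..p-1. U $ i * (1 - fps_X) ^ p $ (p - 1 - i)) = (- 1) ^ a"
    by (simp only: fps_mult_nth)
  have "p_cong p (\<Sum>i=0..p-1. U $ i * (1 - fps_X) ^ p $ (p - 1 - i)) (\<Sum>i=0..p-1. U $ i * of_bool (i = p - 1))"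
  proof (intro p_cong_sum p_cong_mult_left)
    fix i assume i: "i \<in> {0..p - 1}"
    show "p_integral p (U $ i)"
      using i p0 by (auto simp: U_def intro!: p_integral_sum p_integral_T_exp p)
    show "p_cong p ((1 - fps_X) ^ p $ (p - 1 - i)) (of_bool (i = p - 1))"
    proof (cases "i = p - 1")
      case False
      then have "p dvd (p choose (p - 1 - i))"
        using i by (intro dvd_choose_prime p) auto
      then obtain q where "p choose (p - 1 - i) = p * q" by auto
      then have "(1 - fps_X) ^ p $ (p - 1 - i) = of_nat p * ((- 1) ^ (p - 1 - i) * of_nat q :: rat)"
        by (simp add: one_minus_X_power_nth)
      then show ?thesis
        using False p_cong_p_mult[of p "(- 1) ^ (p - 1 - i) * of_nat q"] by (simp add: p_integral_intros)
    qed (auto simp: one_minus_X_power_nth)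
  qed
  also have "(\<Sum>i=0..p-1. U $ i * of_bool (i = p - 1)) = U $ (p - 1)"
    by (simp add: of_bool_def if_distrib cong: if_cong)
  also have "U $ (p - 1) = 1 + (\<Sum>m=1..<p. T_exp a $ m)"
  proof -
    have "{..p - 1} = insert 0 {1..<p}" using p0 by auto
    moreover have "T_exp a $ 0 = 1" by (simp add: T_exp_def)
    ultimately show ?thesis by (simp add: U_def)
  qed
  finally have "p_cong p (1 + (\<Sum>m=1..<p. T_exp a $ m)) ((- 1) ^ a)"
    unfolding top by (rule p_cong_sym)
  then have "p_cong p (1 + (\<Sum>m=1..<p. T_exp a $ m) - 1) ((- 1) ^ a - 1)"
    by (rule p_cong_diff) simp
  then show ?thesis by simp
qed

text \<open>
  The integral of \<open>(((1 + z) / (1 - z))\<^sup>a - 1) / z\<close>, truncated at \<open>z\<^sup>p\<close> and evaluated at \<open>z = 1\<close>. As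
  a polynomial in \<open>a\<close> it generates the finite sums for all \<open>(2, {1}\<^sup>k)\<close>.
\<close>

definition T_exp_integral :: "nat \<Rightarrow> nat \<Rightarrow> rat" where
  "T_exp_integral p a = (\<Sum>m=1..<p. T_exp a $ m / of_nat m)"

lemma T_exp_integral_step:
  assumes p: "prime p" "odd p" and a: "a + 1 < p"
  shows "p_cong p (T_exp_integral p (a + 2) - T_exp_integral p a) (2 * ((- 1) ^ (a + 1) - 1) / of_nat (a + 1))"
proof -
  have "T_exp_integral p (a + 2) - T_exp_integral p a =
      (\<Sum>m=1..<p. (T_exp (a + 2) $ m - T_exp a $ m) / of_nat m)"
    by (simp add: T_exp_integral_def diff_divide_distrib sum_subtractf)
  also have "\<dots> = (\<Sum>m=1..<p. 2 * T_exp (a + 1) $ m / of_nat (a + 1))"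
  proof (intro sum.cong refl)
    fix m assume "m \<in> {1..<p}"
    then show "(T_exp (a + 2) $ m - T_exp a $ m) / of_nat m = 2 * T_exp (a + 1) $ m / of_nat (a + 1)"
      using T_exp_diff[of a m] by (simp add: field_simps)
  qed
  also have "\<dots> = 2 * (\<Sum>m=1..<p. T_exp (a + 1) $ m) / of_nat (a + 1)"
    by (simp add: sum_distrib_left sum_divide_distrib)
  also have "p_cong p \<dots> (2 * ((- 1) ^ (a + 1) - 1) / of_nat (a + 1))"
    using a by (intro p_cong_div_nat p p_cong_mult_left sum_T_exp p_integral_numeral) auto
  finally show ?thesis .
qed

lemma T_exp_integral_0: "T_exp_integral p 0 = 0"
  by (simp add: T_exp_integral_def T_exp_def fps_one_nth)

lemma T_exp_integral_1:
  assumes p: "prime p" "odd p"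
  shows "p_cong p (T_exp_integral p 1) 0"
proof -
  have p2: "p > 2" using p by (metis even_numeral order.not_eq_order_implies_strict prime_ge_2_nat)
  have nth: "T_exp 1 $ m = 2" if "m > 0" for m
    using that
  proof (induction m)
    case (Suc m)
    have "(T_exp 1 * (1 - fps_X)) $ Suc m = (1 + fps_X) $ Suc m"
      using T_exp_power[of 1] by simp
    moreover have "(T_exp 1 * (1 - fps_X)) $ Suc m = T_exp 1 $ Suc m - T_exp 1 $ m"
      by (simp add: right_diff_distrib)
    moreover have "(1 + fps_X :: rat fps) $ Suc m = (if m = 0 then 1 else 0)"
      by (simp add: fps_X_def)
    ultimately have "T_exp 1 $ Suc m = T_exp 1 $ m + (if m = 0 then 1 else 0)" by simp
    moreover have "T_exp 1 $ 0 = 1" by (simp add: T_exp_def)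
    ultimately show ?case using Suc.IH by (cases "m = 0") auto
  qed simp
  have "T_exp_integral p 1 = (\<Sum>m=1..<p. 2 * (1 / of_nat m ^ 1))"
    unfolding T_exp_integral_def using nth by (intro sum.cong refl) auto
  also have "p_cong p \<dots> (\<Sum>m=1..<p. 2 * of_nat m ^ (p - 1 - 1))"
    using p2 by (intro p_cong_sum p_cong_mult_left p_cong_sym[OF p_cong_inverse_power[OF p(1)]]) auto
  also have "\<dots> = 2 * (\<Sum>m=1..<p. of_nat m ^ (p - 1 - 1))"
    by (simp add: sum_distrib_left)
  also have "p_cong p \<dots> (2 * 0)"
    using p2 by (intro p_cong_mult_left power_sum_positive_p_cong_0 p) auto
  finally show ?thesis by simp
qed

text \<open>
  The increments vanish modulo \<open>p\<close> when the exponent in between is even, so all values at odd \<open>a\<close>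
  agree with the one at \<open>1\<close>, which is twice the sum of the reciprocals of all nonzero residues.
\<close>

lemma T_exp_integral_odd:
  assumes p: "prime p" "odd p"
  shows "2 * i + 1 \<le> p \<Longrightarrow> p_cong p (T_exp_integral p (2 * i + 1)) 0"
proof (induction i)
  case 0
  then show ?case using T_exp_integral_1[OF p] by simp
next
  case (Suc i)
  have "p_cong p (T_exp_integral p (2 * i + 1 + 2) - T_exp_integral p (2 * i + 1) + T_exp_integral p (2 * i + 1))
      (2 * ((- 1) ^ (2 * i + 1 + 1) - 1) / of_nat (2 * i + 1 + 1) + 0)"
    using Suc by (intro p_cong_add T_exp_integral_step p Suc.IH) auto
  then show ?case by simp
qed

text \<open>
  Here the exponent in between is odd, and modulo \<open>p\<close> the increment is \<open>-4\<close> divided by it.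
\<close>

lemma T_exp_integral_even:
  assumes p: "prime p" "odd p"
  shows "2 * i < p \<Longrightarrow> p_cong p (T_exp_integral p (2 * i)) (- 4 * (\<Sum>c=1..<2 * i. of_bool (odd c) / of_nat c))"
proof (induction i)
  case 0
  then show ?case using T_exp_integral_0[of p] by simp
next
  case (Suc i)
  let ?S = "\<lambda>i. (\<Sum>c=1..<2 * i. of_bool (odd c) / of_nat c) :: rat"
  have "p_cong p (T_exp_integral p (2 * i + 2) - T_exp_integral p (2 * i) + T_exp_integral p (2 * i))
      (2 * ((- 1) ^ (2 * i + 1) - 1) / of_nat (2 * i + 1) + - 4 * ?S i)"
    using Suc by (intro p_cong_add T_exp_integral_step p Suc.IH) auto
  moreover have "?S (Suc i) = ?S i + 1 / of_nat (2 * i + 1)"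
  proof -
    have "{1..<2 * Suc i} = insert (2 * i + 1) (if i = 0 then {} else insert (2 * i) {1..<2 * i})"
      by auto
    then show ?thesis by simp
  qed
  ultimately show ?case by (simp add: algebra_simps)
qed

lemma T_exp_integral_eq_polynomial:
  "T_exp_integral p a = (\<Sum>d=1..<p. (\<Sum>m=1..<p. T_coeff (replicate d 1) m / of_nat m) * of_nat a ^ d)"
proof -
  have "T_exp_integral p a = (\<Sum>m=1..<p. \<Sum>d=1..<p. T_coeff (replicate d 1) m / of_nat m * of_nat a ^ d)"
    unfolding T_exp_integral_def
  proof (intro sum.cong refl)
    fix m assume m: "m \<in> {1..<p}"
    have "T_exp a $ m = (\<Sum>d=1..<p. of_nat a ^ d * T_coeff (replicate d 1) m)"
      unfolding T_exp_nth
    proof (rule sum.mono_neutral_cong)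
      fix d assume "d \<in> {0..m} - {1..<p}"
      then have "d = 0" using m by auto
      then show "of_nat a ^ d * T_coeff (replicate d 1) m = 0" using m by simp
    next
      fix d assume "d \<in> {1..<p} - {0..m}"
      then show "of_nat a ^ d * T_coeff (replicate d 1) m = 0"
        using T_coeff_ones_eq_0[of m d] by auto
    qed auto
    then show "T_exp a $ m / of_nat m = (\<Sum>d=1..<p. T_coeff (replicate d 1) m / of_nat m * of_nat a ^ d)"
      by (simp add: sum_divide_distrib mult_ac del: T_coeff.simps)
  qed
  also have "\<dots> = (\<Sum>d=1..<p. (\<Sum>m=1..<p. T_coeff (replicate d 1) m / of_nat m) * of_nat a ^ d)"
    unfolding sum_distrib_right by (rule sum.swap)
  finally show ?thesis .
qed

text \<open>
  The finite sum is the coefficient of \<open>a\<^sup>k\<^sup>+\<^sup>1\<close> in \<open>T_exp_integral\<close>; recovered from the values, it is a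
  double sum over even \<open>a\<close> and odd \<open>c < a\<close>. The reflection \<open>(a, c) \<mapsto> (p - c, p - a)\<close>, which preserves
  these conditions as \<open>p\<close> is odd, brings it into the form of \<open>T\<^sub>\<A>(1, k + 1)\<close>.
\<close>

lemma T_trunc_two_ones_reversal:
  assumes p: "prime p" "odd p" and k: "k + 2 < p"
  shows "p_cong p (T_trunc (ones_two_ones 0 k) p) ((- 1) ^ k * T_trunc [1, k + 1] p)"
proof -
  let ?s = "\<lambda>d. \<Sum>m=1..<p. T_coeff (replicate d 1) m / of_nat m"
  let ?j = "k + 1"
  let ?P = "{(a, c). 1 \<le> c \<and> c < a \<and> a < p \<and> even a \<and> odd c}"
  have P: "(\<Sum>a=1..<p. of_bool (even a) * (\<Sum>c=1..<a. of_bool (odd c) * f a c)) = (\<Sum>(a, c)\<in>?P. f a c)"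
    for f :: "nat \<Rightarrow> nat \<Rightarrow> rat"
  proof -
    have "(\<Sum>a=1..<p. of_bool (even a) * (\<Sum>c=1..<a. of_bool (odd c) * f a c)) =
       (\<Sum>(a, c)\<in>(SIGMA a:{1..<p}. {1..<a}). of_bool (even a) * (of_bool (odd c) * f a c))"
      unfolding sum_distrib_left by (rule sum.Sigma) auto
    also have "\<dots> = (\<Sum>(a, c)\<in>?P. f a c)"
      by (rule sum.mono_neutral_cong_right) auto
    finally show ?thesis .
  qed
  have "p_cong p (- ?s ?j) (\<Sum>a=1..<p. of_nat a ^ (p - 1 - ?j) * (\<Sum>d=1..<p. ?s d * of_nat a ^ d))"
    using k p by (intro p_cong_sym[OF coefficient_from_values] p_integral_sum p_integral_div_nat p_integral_T_coeff) auto
  also have "\<dots> = (\<Sum>a=1..<p. of_nat a ^ (p - 1 - ?j) * T_exp_integral p a)"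
    by (simp only: T_exp_integral_eq_polynomial)
  also have "p_cong p \<dots> (\<Sum>a=1..<p. (1 / of_nat a ^ ?j) * (of_bool (even a) * (- 4 * (\<Sum>c=1..<a. of_bool (odd c) / of_nat c))))"
  proof (intro p_cong_sum p_cong_mult p_cong_inverse_power p)
    fix a assume a: "a \<in> {1..<p}"
    show "p_cong p (T_exp_integral p a) (of_bool (even a) * (- 4 * (\<Sum>c=1..<a. of_bool (odd c) / of_nat c)))"
    proof (cases "even a")
      case True
      then show ?thesis using T_exp_integral_even[OF p, of "a div 2"] a by simp
    next
      case False
      then show ?thesis using T_exp_integral_odd[OF p, of "a div 2"] a by simp
    qed
  qed (use k in auto)
  also have "\<dots> = - (\<Sum>a=1..<p. of_bool (even a) * (\<Sum>c=1..<a. of_bool (odd c) * (4 * (1 / of_nat a) ^ ?j * (1 / of_nat c))))"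
    by (simp add: sum_distrib_left sum_negf[symmetric] power_one_over mult_ac del: power_Suc)
  finally have "p_cong p (- (- ?s ?j)) (- (- (\<Sum>(a, c)\<in>?P. 4 * (1 / of_nat a) ^ ?j * (1 / of_nat c))))"
    unfolding P by (rule p_cong_minus)
  moreover have "?s ?j = T_trunc (ones_two_ones 0 k) p"
  proof -
    have "T_trunc (ones_two_ones 0 k) p = (\<Sum>m=1..<p. T_coeff (ones_two_ones 0 k) m)"
      unfolding T_trunc_def by (rule sum.mono_neutral_right) (auto simp: ones_two_ones_0)
    then show ?thesis by (auto simp: ones_two_ones_0 intro!: sum.cong)
  qed
  ultimately have "p_cong p (T_trunc (ones_two_ones 0 k) p) (\<Sum>(a, c)\<in>?P. 4 * (1 / of_nat a) ^ ?j * (1 / of_nat c))"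
    by simp
  also have "(\<Sum>(a, c)\<in>?P. 4 * (1 / of_nat a) ^ ?j * (1 / of_nat c)) =
      (\<Sum>(n, m)\<in>?P. 4 * (1 / of_nat (p - m)) ^ ?j * (1 / of_nat (p - n) :: rat))"
    by (rule sum.reindex_bij_witness[of _ "\<lambda>(n, m). (p - m, p - n)" "\<lambda>(n, m). (p - m, p - n)"])
      (use p in auto)
  also have "p_cong p \<dots> (\<Sum>(n, m)\<in>?P. 4 * (- (1 / of_nat m)) ^ ?j * (- (1 / of_nat n)))"
  proof (rule p_cong_sum)
    fix x assume "x \<in> ?P"
    then obtain n m where x: "x = (n, m)" "1 \<le> m" "m < n" "n < p" by auto
    show "p_cong p (case x of (n, m) \<Rightarrow> 4 * (1 / of_nat (p - m)) ^ ?j * (1 / of_nat (p - n)))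
        (case x of (n, m) \<Rightarrow> 4 * (- (1 / of_nat m)) ^ ?j * (- (1 / of_nat n)))"
      unfolding x(1) prod.case using x
      by (intro p_cong_mult p_cong_power p_cong_inverse_reflect p p_cong_refl p_integral_numeral) auto
  qed
  also have "\<dots> = (- 1) ^ k * (\<Sum>(n, m)\<in>?P. 4 * (1 / of_nat n) * (1 / of_nat m) ^ ?j)"
    unfolding sum_distrib_left
    by (intro sum.cong refl) (auto simp: power_minus[of "1 / _"] mult_ac)
  also have "(\<Sum>(n, m)\<in>?P. 4 * (1 / of_nat n) * (1 / of_nat m) ^ ?j) = T_trunc [1, k + 1] p"
  proof -
    have "T_trunc [1, k + 1] p = (\<Sum>n=1..<p. T_coeff [1, k + 1] n)"
      unfolding T_trunc_def by (rule sum.mono_neutral_right) auto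
    also have "\<dots> = (\<Sum>n=1..<p. of_bool (even n) * (\<Sum>m=1..<n. of_bool (odd m) * (4 * (1 / of_nat n) * (1 / of_nat m) ^ ?j)))"
    proof (intro sum.cong refl)
      fix n assume n: "n \<in> {1..<p}"
      have "(\<Sum>m<n. T_coeff [k + 1] m) = (\<Sum>m=1..<n. T_coeff [k + 1] m)"
        by (rule sum.mono_neutral_right) auto
      also have "\<dots> = (\<Sum>m=1..<n. of_bool (odd m) * (2 * (1 / of_nat m) ^ ?j))"
        by (intro sum.cong refl) (auto simp: power_one_over)
      finally show "T_coeff [1, k + 1] n = of_bool (even n) * (\<Sum>m=1..<n. of_bool (odd m) * (4 * (1 / of_nat n) * (1 / of_nat m) ^ ?j))"
        using n by (subst T_coeff.simps) (simp add: sum_distrib_left mult_ac del: T_coeff.simps power_Suc)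
    qed
    finally show ?thesis unfolding P by simp
  qed
  finally show ?thesis .
qed

section \<open>The values in the ring of residues modulo almost all primes\<close>

text \<open>
  Moving the \<open>2\<close> by one place multiplies the value by \<open>- (k + 1 - l) / (l + 2)\<close>, which is minus the ratio
  of consecutive binomial coefficients.
\<close>

lemma T_trunc_ones_two_ones_bernoulli:
  assumes p: "prime p" "odd p" and k: "odd k" "k + 2 < p"
  shows "l \<le> k \<Longrightarrow> p_cong p (T_trunc (ones_two_ones l (k - l)) p)
     ((- 1) ^ l * of_nat ((k + 2) choose (l + 1)) * (2 - 1 / 2 ^ (k + 1)) *
       (bernoulli_number (p - (k + 2)) / of_nat (k + 2)))"
proof (induction l)
  case 0
  show ?case using T_trunc_two_ones_bernoulli[OF p k] by (simp del: of_nat_Suc of_nat_add power_Suc)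
next
  case (Suc l)
  define c where "c = k - Suc l"
  have c: "k - l = Suc c" "c + 2 = k + 1 - l" using Suc.prems by (auto simp: c_def)
  let ?b = "(2 - 1 / 2 ^ (k + 1)) * (bernoulli_number (p - (k + 2)) / of_nat (k + 2)) :: rat"
  have "even (l + c)" using k Suc.prems by (auto simp: c_def)
  then have "p_cong p (of_nat (l + 2) * T_trunc (ones_two_ones (Suc l) c) p)
     (- (of_nat (c + 2) * T_trunc (ones_two_ones l (Suc c)) p))"
    by (rule T_trunc_move_two[OF p])
  also have "p_cong p \<dots> (- (of_nat (c + 2) * ((- 1) ^ l * of_nat ((k + 2) choose (l + 1)) * ?b)))"
    using Suc unfolding c by (intro p_cong_minus p_cong_mult_left p_integral_nat) (simp add: mult.assoc)
  also have "\<dots> = of_nat (l + 2) * ((- 1) ^ Suc l * of_nat ((k + 2) choose (Suc l + 1)) * ?b)"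
  proof -
    have "(l + 2) * ((k + 2) choose (l + 2)) = ((k + 2) choose (l + 1)) * (c + 2)"
      using c binomial_absorb_comp[of "k + 2" "l + 1"] binomial_absorption[of "l + 1" "k + 2"]
      by (simp add: mult.commute del: binomial_Suc_Suc)
    then have "of_nat (c + 2) * of_nat ((k + 2) choose (l + 1)) = (of_nat (l + 2) * of_nat ((k + 2) choose (l + 2)) :: rat)"
      by (metis mult.commute of_nat_mult)
    then show ?thesis by (simp add: mult_ac del: of_nat_Suc of_nat_add binomial_Suc_Suc)
  qed
  finally have "p_cong p (T_trunc (ones_two_ones (Suc l) c) p) ((- 1) ^ Suc l * of_nat ((k + 2) choose (Suc l + 1)) * ?b)"
    by (rule p_cong_mult_nat_cancel[OF p(1)]) (use Suc.prems k in auto)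
  then show ?case unfolding c_def by (simp only: mult.assoc)
qed

lemma minus_one_power_times_scale: "(- 1) ^ k * x = (- 1) ^ k *\<^sub>A x"
  by (cases "even k") simp_all

theorem corollary4p7:
  fixes k :: nat
  assumes "k > 0"
  shows "T_A (2 # replicate k 1) = (-1) ^ k * T_A [1, k + 1] \<and>
    (odd k \<longrightarrow>
       T_A (2 # replicate k 1) = - T_A [1, k + 1] \<and>
       - T_A [1, k + 1] = ((of_nat k + 2) * (2 - 1 / 2 ^ (k + 1))) *\<^sub>A beta_A (k + 2) \<and>
       ((of_nat k + 2) * (2 - 1 / 2 ^ (k + 1))) *\<^sub>A beta_A (k + 2) =
         ((of_nat k + 2) * (2 ^ (k + 2) - 1) / (2 * (2 ^ (k + 1) - 1))) *\<^sub>A T_A [k + 2]) \<and>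
    (odd k \<longrightarrow> (\<forall>l\<le>k.
       T_A (replicate l 1 @ [2] @ replicate (k - l) 1) =
         ((-1) ^ l * of_nat ((k + 2) choose (l + 1)) * (2 - 1 / 2 ^ (k + 1))) *\<^sub>A beta_A (k + 2)))"
proof -
  let ?b = "\<lambda>p. if p > k + 2 then bernoulli_number (p - (k + 2)) / of_nat (k + 2) else 0"
  have beta: "beta_A (k + 2) = class_A ?b" by (rule beta_A_def)
  have bint: "p_integral p (?b p)" if "prime p" for p
    using that assms by (auto intro!: p_integral_div_nat p_integral_bernoulli_number simp del: of_nat_Suc of_nat_add)
  have two: "2 # replicate k 1 = ones_two_ones 0 k" by (simp add: ones_two_ones_def)
  have reversal: "T_A (2 # replicate k 1) = (- 1) ^ k * T_A [1, k + 1]"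
  proof -
    have "1 *\<^sub>A class_A (T_trunc (ones_two_ones 0 k)) = (- 1) ^ k *\<^sub>A class_A (T_trunc [1, k + 1])"
    proof (rule scale_class_A_eqI[where M = "k + 2"])
      fix p :: nat assume p: "prime p" "k + 2 < p"
      then have "odd p" by (intro prime_odd_nat) auto
      then show "p_integral p (T_trunc (ones_two_ones 0 k) p) \<and> p_integral p (T_trunc [1, k + 1] p) \<and>
          p_cong p (1 * T_trunc (ones_two_ones 0 k) p) ((- 1) ^ k * T_trunc [1, k + 1] p)"
        using T_trunc_two_ones_reversal[of p k] p p_integral_T_trunc by simp
    qed
    then show ?thesis
      by (simp add: two T_A_eq_class_trunc minus_one_power_times_scale del: One_nat_def)
  qed
  have general: "T_A (replicate l 1 @ [2] @ replicate (k - l) 1) =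
      ((-1) ^ l * of_nat ((k + 2) choose (l + 1)) * (2 - 1 / 2 ^ (k + 1))) *\<^sub>A beta_A (k + 2)"
    if k: "odd k" and l: "l \<le> k" for l
  proof -
    have "1 *\<^sub>A class_A (T_trunc (ones_two_ones l (k - l))) =
        ((-1) ^ l * of_nat ((k + 2) choose (l + 1)) * (2 - 1 / 2 ^ (k + 1))) *\<^sub>A class_A ?b"
    proof (rule scale_class_A_eqI[where M = "k + 2"])
      fix p :: nat assume p: "prime p" "k + 2 < p"
      then have "odd p" by (intro prime_odd_nat) auto
      note bernoulli_form = T_trunc_ones_two_ones_bernoulli[OF p(1) this k p(2) l]
      show "p_integral p (T_trunc (ones_two_ones l (k - l)) p) \<and> p_integral p (?b p) \<and>
          p_cong p (1 * T_trunc (ones_two_ones l (k - l)) p)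
            ((-1) ^ l * of_nat ((k + 2) choose (l + 1)) * (2 - 1 / 2 ^ (k + 1)) * ?b p)"
        using bint[OF p(1)] p_integral_T_trunc[OF p(1)] bernoulli_form by (simp only: p(2) if_True mult_1_left)
    qed
    moreover have "replicate l 1 @ [2] @ replicate (k - l) 1 = ones_two_ones l (k - l)"
      by (simp add: ones_two_ones_def)
    ultimately show ?thesis
      by (simp only: beta T_A_eq_class_trunc[OF ones_two_ones_not_Nil] ring_A.scale_one)
  qed
  have single: "((of_nat k + 2) * (2 - 1 / 2 ^ (k + 1))) *\<^sub>A beta_A (k + 2) =
      ((of_nat k + 2) * (2 ^ (k + 2) - 1) / (2 * (2 ^ (k + 1) - 1))) *\<^sub>A T_A [k + 2]"
    (is "?q *\<^sub>A _ = ?r *\<^sub>A _") if k: "odd k"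
  proof -
    have "?q *\<^sub>A class_A ?b = ?r *\<^sub>A class_A (T_trunc [k + 2])"
    proof (rule scale_class_A_eqI[where M = "k + 2"])
      fix p :: nat assume p: "prime p" "k + 2 < p" and r: "p_integral p ?r"
      then have "odd p" by (intro prime_odd_nat) auto
      have "?r * (2 - 1 / 2 ^ k) = ?q"
      proof -
        have "(2 :: rat) ^ (k + 1) > 1" by (rule one_less_power) auto
        then have u: "(2 :: rat) ^ (k + 1) - 1 \<noteq> 0" by simp
        have "(2 - 1 / 2 ^ k :: rat) = (2 ^ (k + 1) - 1) / 2 ^ k"
          and v: "(2 - 1 / 2 ^ (k + 1) :: rat) = (2 ^ (k + 2) - 1) / (2 * 2 ^ k)"
          by (simp_all add: field_simps)
        then have "?r * (2 - 1 / 2 ^ k) =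
            (of_nat k + 2) * (2 ^ (k + 2) - 1) / (2 * (2 ^ (k + 1) - 1)) * ((2 ^ (k + 1) - 1) / 2 ^ k)"
          by (simp only:)
        also have "\<dots> = (of_nat k + 2) * ((2 ^ (k + 2) - 1) / (2 * 2 ^ k))"
        proof -
          have "a * b / (2 * u) * (u / w) = a * (b / (2 * w))" if "u \<noteq> 0" for a b u w :: rat
            using that by simp
          from this[OF u] show ?thesis .
        qed
        also have "\<dots> = ?q" by (simp only: v)
        finally show ?thesis .
      qed
      then have "?q * ?b p = ?r * ((2 - 1 / 2 ^ k) * ?b p)" by (metis mult.assoc)
      also have "p_cong p \<dots> (?r * T_trunc [k + 2] p)"
        using T_trunc_single_bernoulli[OF p(1) \<open>odd p\<close> k p(2)] p(2)
        by (intro p_cong_mult_left r p_cong_sym[of p "T_trunc [k + 2] p"]) simp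
      finally show "p_integral p (?b p) \<and> p_integral p (T_trunc [k + 2] p) \<and> p_cong p (?q * ?b p) (?r * T_trunc [k + 2] p)"
        using p bint p_integral_T_trunc by blast
    qed
    then show ?thesis by (simp only: beta T_A_eq_class_trunc[of "[k + 2]"] list.distinct not_False_eq_True)
  qed
  have "- T_A [1, k + 1] = ((of_nat k + 2) * (2 - 1 / 2 ^ (k + 1))) *\<^sub>A beta_A (k + 2)" if "odd k"
    using general[OF that, of 0] reversal that by (simp add: add.commute)
  then show ?thesis using reversal general single by simp
qed

end
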